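(* Let $\delta\in[0,1)$, let $\sigma,\eta\in\mathcal M([-1,1])$, and let $\bar\eta:=\Phi_\delta(\sigma;\eta)$ be their I.F.S. convolution. Then the Jacobi matrix $J_{\bar\eta}$ can be computed recursively from $\delta$ and the Jacobi matrices $J_\sigma$ and $J_\eta$. Moreover, for every $\bar n\ge 1$, the computation of the truncation $J^{(\bar n)}_{\bar\eta}$ only requires knowledge of ($\delta$ and) the truncated matrices $J^{(\bar n)}_\sigma$ and $J^{(\bar n)}_\eta$; that is, there is a recursive procedure which, given $\delta$, $J^{(\bar n)}_\sigma$ and $J^{(\bar n)}_\eta$ as input, outputs $J^{(\bar n)}_{\bar\eta}$.
   Context: $\mathcal M([-1,1])$ is the set of positive Borel probability measures on $\mathbf R$ with support contained in $[-1,1]$. For $\delta\in[0,1)$ put $\bar\delta:=1-\delta$ and $\phi(\beta,s):=\delta s+\bar\delta\beta$. For $\sigma,\eta\in\mathcal M([-1,1])$, the I.F.S. convolution $\bar\eta=\Phi_\delta(\sigma;\eta)\in\mathcal M([-1,1])$ is the measure defined by $\int f(s)\,d\bar\eta(s)=\int d\sigma(\beta)\int d\eta(s)\,f(\phi(\beta,s))$ for every continuous function $f$. For a compactly supported probability measure $\nu$ on $\mathbf R$, $p_n(\nu;s)$ denotes the orthonormal polynomial of degree $n$ (positive leading coefficient), satisfying $s\,p_n(\nu;s)=b_{n+1}(\nu)p_{n+1}(\nu;s)+a_n(\nu)p_n(\nu;s)+b_n(\nu)p_{n-1}(\nu;s)$, with $b_0(\nu)=0$, $p_{-1}=0$, $p_0=1$.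 The Jacobi matrix $J_\nu$ is the symmetric tridiagonal matrix with diagonal $a_0(\nu),a_1(\nu),\dots$ and off-diagonal $b_1(\nu),b_2(\nu),\dots$; $J_\nu^{(\bar n)}$ is its leading $\bar n\times\bar n$ truncation. If the support of $\nu$ consists of exactly $M<\infty$ points, $J_\nu$ is the $M\times M$ matrix with entries $a_0,\dots,a_{M-1}$, $b_1,\dots,b_{M-1}$ (and one sets $b_j(\nu)=0$ for $j\ge M$), and $J_\nu^{(\bar n)}:=J_\nu$ for $\bar n\ge M$. "Computed recursively" means: the entries $a_0,b_1,a_1,b_2,\dots$ of the output matrix are generated successively, in order of increasing index, each by finitely many real arithmetic operations, square roots and tests for zero applied to the input data and previously computed quantities. *)

theory Defs
  imports "HOL-Probability.Probability" "HOL-Computational_Algebra.Polynomial"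
begin

section \<open>Measures on $[-1,1]$ and the I.F.S. convolution\<close>

definition msupport :: "real measure \<Rightarrow> real set" where
  "msupport \<nu> = {x. \<forall>U. open U \<and> x \<in> U \<longrightarrow> measure \<nu> U > 0}"

definition prob_measures :: "real measure set" where
  "prob_measures = {\<nu>. prob_space \<nu> \<and> sets \<nu> = sets borel \<and> msupport \<nu> \<subseteq> {-1..1}}"

definition ifs_map :: "real \<Rightarrow> real \<Rightarrow> real \<Rightarrow> real" where
  "ifs_map \<delta> \<beta> s = \<delta> * s + (1 - \<delta>) * \<beta>"

text \<open>Existence and uniqueness of the measure described here are proved below.\<close>

definition ifs_convolution :: "real \<Rightarrow> real measure \<Rightarrow> real measure \<Rightarrow> real measure" where
  "ifs_convolution \<delta> \<sigma> \<eta> = (THE \<mu>. \<mu> \<in> prob_measures \<and>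
     (\<forall>f :: real \<Rightarrow> real. continuous_on UNIV f \<longrightarrow>
        (\<integral>s. f s \<partial>\<mu>) = (\<integral>\<beta>. (\<integral>s. f (ifs_map \<delta> \<beta> s) \<partial>\<eta>) \<partial>\<sigma>)))"

lemma prob_measures_AE:
  assumes "\<nu> \<in> prob_measures"
  shows "AE x in \<nu>. x \<in> {-1..1}"
proof -
  interpret prob_space \<nu> using assms by (simp add: prob_measures_def)
  have sets[simp]: "sets \<nu> = sets borel" using assms by (simp add: prob_measures_def)
  define F where "F = {U. open U \<and> measure \<nu> U = 0}"
  obtain F' where F': "F' \<subseteq> F" "countable F'" "\<Union>F' = \<Union>F"
    using Lindelof[of F] by (auto simp: F_def)
  have "(\<Union>U\<in>F'. U) \<in> null_sets \<nu>"
    using F' by (intro null_sets_UN') (auto simp: F_def null_sets_def emeasure_eq_measure)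
  then have null: "\<Union>F \<in> null_sets \<nu>" using F' by simp
  have sub: "x \<in> {-1..1}" if "x \<notin> \<Union>F" for x
  proof -
    have "x \<in> msupport \<nu>"
      using that by (auto simp: F_def msupport_def zero_less_measure_iff)
    then show ?thesis using assms by (auto simp: prob_measures_def)
  qed
  show ?thesis
    by (rule AE_I'[OF null]) (use sub in auto)
qed

lemma prob_measuresI:
  assumes "prob_space \<nu>" "sets \<nu> = sets borel" "AE x in \<nu>. x \<in> {-1..1::real}"
  shows "\<nu> \<in> prob_measures"
proof -
  interpret prob_space \<nu> by fact
  have "x \<in> {-1..1}" if "x \<in> msupport \<nu>" for x
  proof (rule ccontr)
    assume "x \<notin> {-1..1}"
    moreover have "open (- {-1..1::real})" by (simp add: open_Compl)
    ultimately have "measure \<nu> (- {-1..1}) > 0" using that by (auto simp: msupport_def)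
    moreover have "measure \<nu> (- {-1..1}) = 0"
    proof -
      have "measure \<nu> (- {-1..1}) = measure \<nu> {}"
        using assms by (intro finite_measure_eq_AE) auto
      then show ?thesis by simp
    qed
    ultimately show False by simp
  qed
  then show ?thesis using assms by (auto simp: prob_measures_def)
qed

lemma prob_measures_eqI:
  assumes "\<mu> \<in> prob_measures" "\<nu> \<in> prob_measures"
    and eq: "\<And>f :: real \<Rightarrow> real. continuous_on UNIV f \<Longrightarrow> (\<integral>s. f s \<partial>\<mu>) = (\<integral>s. f s \<partial>\<nu>)"
  shows "\<mu> = \<nu>"
proof -
  have rd: "real_distribution M" if "M \<in> prob_measures" for M
    using that sets_eq_imp_space_eq[of M borel]
    by (auto simp: prob_measures_def real_distribution_def real_distribution_axioms_def)
  interpret M: real_distribution \<mu> using rd assms by blast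
  interpret N: real_distribution \<nu> using rd assms by blast
  have "char \<mu> t = char \<nu> t" for t
  proof (rule complex_eqI)
    have int: "integrable M (\<lambda>x. iexp (t * x))" if "real_distribution M" for M
    proof -
      interpret real_distribution M by fact
      show ?thesis by (rule integrable_const_bound[of _ 1]) auto
    qed
    have *: "Re (char M t) = (\<integral>x. cos (t * x) \<partial>M)" "Im (char M t) = (\<integral>x. sin (t * x) \<partial>M)"
      if "real_distribution M" for M
      unfolding char_def using int[OF that]
      by (simp_all flip: integral_Re integral_Im add: Re_exp Im_exp)
    show "Re (char \<mu> t) = Re (char \<nu> t)"
      using eq[of "\<lambda>x. cos (t * x)"]
      by (simp add: * M.real_distribution_axioms N.real_distribution_axioms continuous_intros)
    show "Im (char \<mu> t) = Im (char \<nu> t)"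
      using eq[of "\<lambda>x. sin (t * x)"]
      by (simp add: * M.real_distribution_axioms N.real_distribution_axioms continuous_intros)
  qed
  then show ?thesis
    using Levy_uniqueness[OF M.real_distribution_axioms N.real_distribution_axioms] by auto
qed

lemma ifs_convolution_distr:
  fixes f :: "real \<Rightarrow> real"
  assumes "0 \<le> \<delta>" "\<delta> < 1" and \<sigma>: "\<sigma> \<in> prob_measures" and \<eta>: "\<eta> \<in> prob_measures"
  defines "\<mu> \<equiv> distr (\<sigma> \<Otimes>\<^sub>M \<eta>) borel (\<lambda>(\<beta>, s). ifs_map \<delta> \<beta> s)"
  shows "\<mu> \<in> prob_measures"
    and "continuous_on UNIV f \<Longrightarrow>
           (\<integral>s. f s \<partial>\<mu>) = (\<integral>\<beta>. (\<integral>s. f (ifs_map \<delta> \<beta> s) \<partial>\<eta>) \<partial>\<sigma>)"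
proof -
  interpret S: prob_space \<sigma> using \<sigma> by (simp add: prob_measures_def)
  interpret E: prob_space \<eta> using \<eta> by (simp add: prob_measures_def)
  interpret P: pair_prob_space \<sigma> \<eta> ..
  have [measurable_cong]: "sets \<sigma> = sets borel" "sets \<eta> = sets borel"
    using \<sigma> \<eta> by (auto simp: prob_measures_def)
  have meas [measurable]: "(\<lambda>(\<beta>, s). ifs_map \<delta> \<beta> s) \<in> \<sigma> \<Otimes>\<^sub>M \<eta> \<rightarrow>\<^sub>M borel"
    unfolding ifs_map_def by measurable
  have conv: "ifs_map \<delta> \<beta> s \<in> {-1..1}" if "\<beta> \<in> {-1..1}" "s \<in> {-1..1}" for \<beta> s
  proof -
    have "\<delta> *\<^sub>R s + (1 - \<delta>) *\<^sub>R \<beta> \<in> {-1..1}"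
      using that assms(1,2) convex_real_interval(5)[of "-1" 1]
      by (intro convexD) auto
    then show ?thesis by (simp add: ifs_map_def)
  qed
  have "AE \<beta> in \<sigma>. AE s in \<eta>. ifs_map \<delta> \<beta> s \<in> {-1..1}"
    using prob_measures_AE[OF \<sigma>]
  proof eventually_elim
    case (elim \<beta>)
    show ?case using prob_measures_AE[OF \<eta>] by eventually_elim (use elim conv in blast)
  qed
  then have AE: "AE z in \<sigma> \<Otimes>\<^sub>M \<eta>. (case z of (\<beta>, s) \<Rightarrow> ifs_map \<delta> \<beta> s) \<in> {-1..1}"
    by (intro P.AE_pair_measure) (auto simp: case_prod_unfold)
  show "\<mu> \<in> prob_measures"
  proof (rule prob_measuresI)
    show "prob_space \<mu>" unfolding \<mu>_def by (rule P.prob_space_distr) simp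
    show "AE x in \<mu>. x \<in> {-1..1}" unfolding \<mu>_def by (subst AE_distr_iff) (use AE in auto)
  qed (simp add: \<mu>_def)
  assume f: "continuous_on UNIV f"
  then have [measurable]: "f \<in> borel_measurable borel" by (rule borel_measurable_continuous_onI)
  have "compact (f ` {-1..1})"
    using f by (intro compact_continuous_image) (auto intro: continuous_on_subset)
  then obtain B where B: "\<And>x. x \<in> {-1..1} \<Longrightarrow> norm (f x) \<le> B"
    by (meson bounded_iff compact_imp_bounded imageI)
  have "integrable (\<sigma> \<Otimes>\<^sub>M \<eta>) (\<lambda>(\<beta>, s). f (ifs_map \<delta> \<beta> s))"
  proof (rule P.integrable_const_bound[of _ B])
    show "AE z in \<sigma> \<Otimes>\<^sub>M \<eta>. norm (case z of (\<beta>, s) \<Rightarrow> f (ifs_map \<delta> \<beta> s)) \<le> B"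
      using AE by eventually_elim (use B in auto)
    show "(\<lambda>(\<beta>, s). f (ifs_map \<delta> \<beta> s)) \<in> borel_measurable (\<sigma> \<Otimes>\<^sub>M \<eta>)"
      unfolding ifs_map_def by measurable
  qed
  from P.integral_fst'[OF this]
  show "(\<integral>s. f s \<partial>\<mu>) = (\<integral>\<beta>. (\<integral>s. f (ifs_map \<delta> \<beta> s) \<partial>\<eta>) \<partial>\<sigma>)"
    unfolding \<mu>_def by (subst integral_distr) (auto simp: case_prod_unfold)
qed

lemma ifs_convolution_eq_distr:
  assumes "0 \<le> \<delta>" "\<delta> < 1" "\<sigma> \<in> prob_measures" "\<eta> \<in> prob_measures"
  shows "ifs_convolution \<delta> \<sigma> \<eta> = distr (\<sigma> \<Otimes>\<^sub>M \<eta>) borel (\<lambda>(\<beta>, s). ifs_map \<delta> \<beta> s)"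
  unfolding ifs_convolution_def
  using ifs_convolution_distr[OF assms]
  by (intro the_equality) (auto intro!: prob_measures_eqI)


section \<open>Orthonormal polynomials and Jacobi matrices\<close>

definition supp_size :: "real measure \<Rightarrow> enat" where
  "supp_size \<nu> = (if finite (msupport \<nu>) then enat (card (msupport \<nu>)) else \<infinity>)"

definition orthonormal_polys :: "real measure \<Rightarrow> (nat \<Rightarrow> real poly) \<Rightarrow> bool" where
  "orthonormal_polys \<nu> p \<longleftrightarrow>
     (\<forall>n. enat n < supp_size \<nu> \<longrightarrow> degree (p n) = n \<and> lead_coeff (p n) > 0) \<and>
     (\<forall>m n. enat m < supp_size \<nu> \<longrightarrow> enat n < supp_size \<nu> \<longrightarrow>
        (\<integral>s. poly (p m) s * poly (p n) s \<partial>\<nu>) = (if m = n then 1 else 0))"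

text \<open>If the support has exactly $M < \infty$ points, the recurrence for $n = M - 1$ does not hold
  as an identity of polynomials (the degrees differ), but as one of functions on the support,
  with $b_M = 0$.\<close>

definition recurrence_coeffs ::
    "real measure \<Rightarrow> (nat \<Rightarrow> real poly) \<Rightarrow> (nat \<Rightarrow> real) \<Rightarrow> (nat \<Rightarrow> real) \<Rightarrow> bool" where
  "recurrence_coeffs \<nu> p a b \<longleftrightarrow>
     b 0 = 0 \<and> (\<forall>j. supp_size \<nu> \<le> enat j \<longrightarrow> b j = 0) \<and>
     (\<forall>n. enat n < supp_size \<nu> \<longrightarrow>
        (\<forall>s. enat (Suc n) < supp_size \<nu> \<or> s \<in> msupport \<nu> \<longrightarrow>
           s * poly (p n) s =
             b (Suc n) * poly (p (Suc n)) s + a n * poly (p n) s +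
             (if n = 0 then 0 else b n * poly (p (n - 1)) s)))"

text \<open>Square matrices, finite or infinite, with rows and columns numbered from 0; the entries
  outside a finite matrix are taken to be 0, so that matrices are equal as soon as their sizes and
  proper entries agree.\<close>

datatype sqmat = Sqmat (msize: enat) (entry: "nat \<Rightarrow> nat \<Rightarrow> real")

definition mk_sqmat :: "enat \<Rightarrow> (nat \<Rightarrow> nat \<Rightarrow> real) \<Rightarrow> sqmat" where
  "mk_sqmat N f = Sqmat N (\<lambda>i j. if enat i < N \<and> enat j < N then f i j else 0)"

definition tridiagonal :: "enat \<Rightarrow> (nat \<Rightarrow> real) \<Rightarrow> (nat \<Rightarrow> real) \<Rightarrow> sqmat" where
  "tridiagonal N a b = mk_sqmat N (\<lambda>i j.
     if i = j then a i else if j = Suc i then b j else if i = Suc j then b i else 0)"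

definition truncation :: "nat \<Rightarrow> sqmat \<Rightarrow> sqmat" where
  "truncation n A = mk_sqmat (min (enat n) (msize A)) (entry A)"

definition jacobi :: "real measure \<Rightarrow> sqmat" where
  "jacobi \<nu> = (THE J. \<exists>p a b. orthonormal_polys \<nu> p \<and> recurrence_coeffs \<nu> p a b \<and>
                                J = tridiagonal (supp_size \<nu>) a b)"

text \<open>For a tridiagonal symmetric matrix of finite size: $a_0, b_1, a_1, b_2, a_2, \dots$\<close>

definition entry_list :: "sqmat \<Rightarrow> real list" where
  "entry_list A = concat (map
     (\<lambda>i. if i = 0 then [entry A 0 0] else [entry A (i - 1) i, entry A i i])
     [0..<the_enat (msize A)])"


section \<open>Recursive procedures over the reals\<close>

text \<open>A procedure is a finite program that works on a real memory, addressed by lists of natural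
  numbers, and on natural-number registers, which serve for addressing and loop control only.
  The sole constants are 0 and 1; apart from arithmetic, square roots and tests for zero, nothing
  can be done with real numbers. The programs have no unbounded loops, so each execution performs
  finitely many operations. Dividing by zero and taking the square root of a negative number abort
  the execution (\<open>None\<close>), as opposed to the total functions \<open>/\<close> and \<open>sqrt\<close>.\<close>

datatype idx = Num nat | Reg nat | Plus idx idx | Minus idx idx

datatype rexp =
    Zero | One
  | Delta | Sigma_entry idx idx | Eta_entry idx idx
  | Mem "idx list"
  | Add rexp rexp | Sub rexp rexp | Mul rexp rexp | Div rexp rexp | Sqrt rexp

datatype com =
    Skip
  | Set_Reg nat idx
  | Store "idx list" rexp
  | Seq com com
  | If_Zero rexp com com
  | If_Eq idx idx com com
  | For nat idx com
  | Emit rexp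

datatype input = Input (in_delta: real) (in_sigma: sqmat) (in_eta: sqmat)

datatype state = State (regs: "nat \<Rightarrow> nat") (mem: "nat list \<Rightarrow> real") (emitted: "real list")

primrec ival :: "(nat \<Rightarrow> nat) \<Rightarrow> idx \<Rightarrow> nat" where
  "ival r (Num n) = n"
| "ival r (Reg i) = r i"
| "ival r (Plus e f) = ival r e + ival r f"
| "ival r (Minus e f) = ival r e - ival r f"

abbreviation lift2 :: "(real \<Rightarrow> real \<Rightarrow> real option) \<Rightarrow> real option \<Rightarrow> real option \<Rightarrow> real option"
  where "lift2 g u v \<equiv> Option.bind u (\<lambda>x. Option.bind v (g x))"

primrec rval :: "input \<Rightarrow> state \<Rightarrow> rexp \<Rightarrow> real option" where
  "rval inp st Zero = Some 0"
| "rval inp st One = Some 1"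
| "rval inp st Delta = Some (in_delta inp)"
| "rval inp st (Sigma_entry e f) = Some (entry (in_sigma inp) (ival (regs st) e) (ival (regs st) f))"
| "rval inp st (Eta_entry e f) = Some (entry (in_eta inp) (ival (regs st) e) (ival (regs st) f))"
| "rval inp st (Mem es) = Some (mem st (map (ival (regs st)) es))"
| "rval inp st (Add e f) = lift2 (\<lambda>x y. Some (x + y)) (rval inp st e) (rval inp st f)"
| "rval inp st (Sub e f) = lift2 (\<lambda>x y. Some (x - y)) (rval inp st e) (rval inp st f)"
| "rval inp st (Mul e f) = lift2 (\<lambda>x y. Some (x * y)) (rval inp st e) (rval inp st f)"
| "rval inp st (Div e f) =
     lift2 (\<lambda>x y. if y = 0 then None else Some (x / y)) (rval inp st e) (rval inp st f)"
| "rval inp st (Sqrt e) =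
     Option.bind (rval inp st e) (\<lambda>x. if x < 0 then None else Some (sqrt x))"

primrec exec :: "input \<Rightarrow> com \<Rightarrow> state \<Rightarrow> state option" where
  "exec inp Skip st = Some st"
| "exec inp (Set_Reg i e) st =
     Some (State ((regs st)(i := ival (regs st) e)) (mem st) (emitted st))"
| "exec inp (Store es e) st = Option.bind (rval inp st e)
     (\<lambda>x. Some (State (regs st) ((mem st)(map (ival (regs st)) es := x)) (emitted st)))"
| "exec inp (Seq c d) st = Option.bind (exec inp c st) (exec inp d)"
| "exec inp (If_Zero e c d) st =
     Option.bind (rval inp st e) (\<lambda>x. if x = 0 then exec inp c st else exec inp d st)"
| "exec inp (If_Eq e f c d) st =
     (if ival (regs st) e = ival (regs st) f then exec inp c st else exec inp d st)"
| "exec inp (For i e c) st =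
     fold (\<lambda>k so. Option.bind so
            (\<lambda>s. exec inp c (State ((regs s)(i := k)) (mem s) (emitted s))))
       [0..<ival (regs st) e] (Some st)"
| "exec inp (Emit e) st =
     Option.bind (rval inp st e) (\<lambda>x. Some (State (regs st) (mem st) (emitted st @ [x])))"

text \<open>The procedure given by \<open>P\<close> executes \<open>P\<close> over and over again, keeping everything computed so
  far, and \<open>output_after n\<close> is all it has emitted in the first \<open>n\<close> rounds.\<close>

definition output_after :: "com \<Rightarrow> input \<Rightarrow> nat \<Rightarrow> real list option" where
  "output_after P inp n = map_option emitted
     (((\<lambda>so. Option.bind so (exec inp P)) ^^ n) (Some (State (\<lambda>_. 0) (\<lambda>_. 0) [])))"

text \<open>Each round yields one more row of \<open>C\<close>: \<open>a\<^sub>0\<close> in the first, \<open>b\<^sub>n\<close> and \<open>a\<^sub>n\<close> in the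
  following ones, and nothing once a finite \<open>C\<close> is exhausted.\<close>

definition generates :: "com \<Rightarrow> input \<Rightarrow> sqmat \<Rightarrow> bool" where
  "generates P inp C \<longleftrightarrow> (\<forall>n. output_after P inp n = Some (entry_list (truncation n C)))"

end

theory Submission
  imports Defs
begin

text \<open>The program runs the Lanczos algorithm in two variables. Let $A$ be multiplication by
$\phi(\beta,s) = \delta s + \bar\delta\beta$ on $L^2(\sigma\times\eta)$. Since $\bar\eta$ is the
image of $\sigma\times\eta$ under $\phi$, a polynomial $p$ has the same norm in $L^2(\bar\eta)$ as
$p(\phi(\beta,s))$ in $L^2(\sigma\times\eta)$, and multiplication by the variable goes over
into $A$. In the orthonormal basis $p_i(\sigma;\beta)\,p_j(\eta;s)$ the operator $A$ is
$\bar\delta\,J_\sigma\otimes 1 + \delta\,1\otimes J_\eta$. The three-term recurrence for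
$p_n(\bar\eta;\cdot)$ thus becomes a recurrence for its coefficient arrays in this basis, starting
from the array of the constant 1 and using only entries of $J_\sigma$ and $J_\eta$; $a_n$ and
$b_n$ are inner products and norms of such arrays. As $p_n(\bar\eta;\phi(\beta,s))$ has degree at
most $n$ in each variable, its array vanishes outside $i, j \le n$. Hence row $n$ of the output uses
only entries of $J_\sigma$ and $J_\eta$ with indices at most $n$, which gives the claim about
truncations together with the first one.

Finite supports need no separate treatment. The orthonormal polynomials \<open>opoly\<close> are defined by the
three-term recurrence with the convention $w/0 = 0$, so that from the number of support points on
all $p_n$, $a_n$, $b_n$ are zero; the $p_n$ that remain form an orthonormal basis of the
polynomials in $L^2$, as \<open>parseval\<close> states. That identity carries the whole change of basis: applied
in each variable it yields \<open>parseval_conv\<close> (inner products are computed from arrays) and \<open>coef_X\<close>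
(the matrix of $A$). Testing $b_n = 0$ is therefore enough for the program to notice that the output
matrix is exhausted.

The arguments about polynomials depend on a measure only through its moments, so they are carried
out for a positive functional on polynomials. Measures enter in \<open>opoly_moment_nonzero_iff\<close>, where
the number of nonzero $p_n$ is identified with the number of support points, and in \<open>jacobi_eq\<close>,
which identifies the coefficients of the recurrence with the Jacobi matrix.\<close>

section \<open>Positive functionals and their orthonormal polynomials\<close>

lemma poly_ext: "(\<And>x. poly p x = poly q x) \<Longrightarrow> p = q" for p q :: "real poly"
  using poly_eq_poly_eq_iff by blast

text \<open>The properties of $p \mapsto \int p\,d\nu$ for a probability measure $\nu$ that the theory of
orthogonal polynomials uses. \<open>L (p * p) = 0\<close> is possible for \<open>p \<noteq> 0\<close>, which is how finitely
supported measures are included.\<close>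

locale moment_functional =
  fixes L :: "real poly \<Rightarrow> real"
  assumes L_add: "L (p + q) = L p + L q"
    and L_smult: "L (smult c p) = c * L p"
    and L_nonneg: "L (p * p) \<ge> 0"
    and L_1: "L 1 = 1"
begin

lemma L_0 [simp]: "L 0 = 0"
  using L_smult[of 0 0] by simp

lemma L_minus: "L (- p) = - L p"
  using L_smult[of "-1" p] by simp

lemma L_diff: "L (p - q) = L p - L q"
  using L_add[of p "- q"] by (simp add: L_minus)

text \<open>The null space of a positive semidefinite form is orthogonal to everything: otherwise
\<open>L ((t p + q)\<^sup>2)\<close>, an affine function of \<open>t\<close> when \<open>L (p\<^sup>2) = 0\<close>, would become negative.\<close>

lemma L_null:
  assumes "L (p * p) = 0"
  shows "L (p * q) = 0"
proof (rule ccontr)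
  assume nz: "L (p * q) \<noteq> 0"
  \<comment> \<open>This \<open>t\<close> gives \<open>L ((t p + q)\<^sup>2) = - 1\<close>.\<close>
  define t where "t = - (L (q * q) + 1) / (2 * L (p * q))"
  define f where "f = smult t p + q"
  have "f * f = smult (t * t) (p * p) + (smult t (p * q) + smult t (p * q)) + q * q"
    by (simp add: f_def algebra_simps)
  then have "L (f * f) = t * t * L (p * p) + 2 * t * L (p * q) + L (q * q)"
    by (simp only: L_add L_smult)
  also have "\<dots> = - 1"
    using assms nz by (simp add: t_def field_simps)
  finally show False
    using L_nonneg[of f] by simp
qed

end

definition X :: "real poly" where "X = [:0, 1:]"

text \<open>What is left of \<open>X * p\<close> after removing its components along the last two orthonormal polynomials,
\<open>p\<close> and its predecessor \<open>q\<close>.\<close>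

definition lanczos_step :: "(real poly \<Rightarrow> real) \<Rightarrow> real poly \<Rightarrow> real poly \<Rightarrow> real poly" where
  "lanczos_step L p q = X * p - smult (L (X * p * p)) p - smult (L (X * p * q)) q"

definition L2norm :: "(real poly \<Rightarrow> real) \<Rightarrow> real poly \<Rightarrow> real" where
  "L2norm L p = sqrt (L (p * p))"

text \<open>The pair consists of $p_n$ and $p_{n-1}$, with $p_{-1} = 0$. By \<open>inverse 0 = 0\<close>, the polynomial
following a residual of norm zero is 0, and so are all later ones.\<close>

primrec opoly_pair :: "(real poly \<Rightarrow> real) \<Rightarrow> nat \<Rightarrow> real poly \<times> real poly" where
  "opoly_pair L 0 = (1, 0)"
| "opoly_pair L (Suc n) = (let (p, q) = opoly_pair L n; w = lanczos_step L p q
     in (smult (inverse (L2norm L w)) w, p))"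

definition opoly :: "(real poly \<Rightarrow> real) \<Rightarrow> nat \<Rightarrow> real poly" where
  "opoly L n = fst (opoly_pair L n)"

definition opoly_prev :: "(real poly \<Rightarrow> real) \<Rightarrow> nat \<Rightarrow> real poly" where
  "opoly_prev L n = snd (opoly_pair L n)"

definition residual :: "(real poly \<Rightarrow> real) \<Rightarrow> nat \<Rightarrow> real poly" where
  "residual L n = lanczos_step L (opoly L n) (opoly_prev L n)"

definition jac_a :: "(real poly \<Rightarrow> real) \<Rightarrow> nat \<Rightarrow> real" where
  "jac_a L n = L (X * opoly L n * opoly L n)"

definition jac_b :: "(real poly \<Rightarrow> real) \<Rightarrow> nat \<Rightarrow> real" where
  "jac_b L n = (case n of 0 \<Rightarrow> 0 | Suc m \<Rightarrow> L2norm L (residual L m))"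

lemma opoly_0 [simp]: "opoly L 0 = 1"
  by (simp add: opoly_def)

lemma opoly_prev_0 [simp]: "opoly_prev L 0 = 0"
  by (simp add: opoly_prev_def)

lemma opoly_prev_Suc [simp]: "opoly_prev L (Suc n) = opoly L n"
  by (simp add: opoly_prev_def opoly_def case_prod_unfold Let_def)

lemma jac_b_0 [simp]: "jac_b L 0 = 0"
  by (simp add: jac_b_def)

lemma opoly_Suc: "opoly L (Suc n) = smult (inverse (jac_b L (Suc n))) (residual L n)"
  by (simp add: opoly_def opoly_prev_def jac_b_def residual_def case_prod_unfold Let_def)

context moment_functional
begin

lemma jac_b_nonneg: "jac_b L n \<ge> 0"
  using L_nonneg by (simp add: jac_b_def L2norm_def split: nat.split)

lemma jac_b_Suc_sq: "(jac_b L (Suc n))\<^sup>2 = L (residual L n * residual L n)"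
  using L_nonneg by (simp add: jac_b_def L2norm_def)

text \<open>Inside \<open>L\<close>, the residual may be replaced by $b_{n+1}p_{n+1}$ even if $b_{n+1} = 0$, although the two
polynomials then differ: the residual has norm zero and is invisible to \<open>L\<close> by \<open>L_null\<close>.\<close>

lemma L_residual: "L (residual L n * q) = jac_b L (Suc n) * L (opoly L (Suc n) * q)"
proof (cases "jac_b L (Suc n) = 0")
  case True
  then show ?thesis
    using L_null[of "residual L n" q] jac_b_Suc_sq[of n] by simp
qed (simp add: opoly_Suc L_smult)

lemma opoly_normalized: "opoly L n = 0 \<and> L (opoly L n * opoly L n) = 0 \<or> L (opoly L n * opoly L n) = 1"
proof (cases n)
  case 0
  then show ?thesis by (simp add: L_1)
next
  case (Suc m)
  then show ?thesis
    using jac_b_Suc_sq[of m]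
    by (cases "jac_b L n = 0") (auto simp: opoly_Suc L_smult power2_eq_square field_simps)
qed

lemma opoly_eq_0_iff: "opoly L (Suc n) = 0 \<longleftrightarrow> jac_b L (Suc n) = 0"
proof
  assume "opoly L (Suc n) = 0"
  then have "L (residual L n * residual L n) = 0" using L_residual[of n "residual L n"] by simp
  then show "jac_b L (Suc n) = 0" using jac_b_Suc_sq[of n] by simp
qed (simp add: opoly_Suc)

lemma opoly_eq_0_Suc:
  assumes "opoly L n = 0"
  shows "opoly L (Suc n) = 0"
proof (cases n)
  case 0
  with assms show ?thesis by simp
next
  case (Suc m)
  have "residual L n = 0" using assms by (simp add: residual_def lanczos_step_def)
  then show ?thesis by (simp add: opoly_Suc)
qed

lemma opoly_eq_0_mono: "m \<le> n \<Longrightarrow> opoly L m = 0 \<Longrightarrow> opoly L n = 0"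
  by (induction n rule: dec_induct) (auto intro: opoly_eq_0_Suc)

text \<open>The three-term recurrence, tested against a polynomial \<open>q\<close>. The last coefficient is still
in the form in which \<open>lanczos_step\<close> defines it; that it equals $b_n$ depends on orthogonality and is
shown in \<open>L_X_opoly_prev\<close>.\<close>

lemma L_X_opoly_aux:
  "L (X * opoly L n * q) = jac_b L (Suc n) * L (opoly L (Suc n) * q) + jac_a L n * L (opoly L n * q)
      + L (X * opoly L n * opoly_prev L n) * L (opoly_prev L n * q)"
proof -
  have "X * opoly L n * q = residual L n * q + smult (jac_a L n) (opoly L n * q)
      + smult (L (X * opoly L n * opoly_prev L n)) (opoly_prev L n * q)"
    by (simp add: residual_def lanczos_step_def jac_a_def algebra_simps)
  then show ?thesis by (simp only: L_add L_smult L_residual)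
qed

text \<open>The residual is orthogonal to the last two polynomials by construction. For an earlier $p_m$,
symmetry of multiplication by $x$ moves the factor $x$ to $p_m$, and $x p_m$ is a combination of
$p_{m-1}$, $p_m$, $p_{m+1}$, all of index less than the current one.\<close>

lemma opoly_orthogonal: "m < n \<Longrightarrow> L (opoly L n * opoly L m) = 0"
proof (induction n arbitrary: m rule: less_induct)
  case (less n)
  then obtain k where n: "n = Suc k" by (cases n) auto
  have orth: "L (opoly L i * opoly L j) = 0" if "i \<le> k" "j \<le> k" "i \<noteq> j" for i j
    using that less.IH[of i j] less.IH[of j i] n by (cases "i < j") (auto simp: mult.commute)
  have self: "opoly L i = 0 \<or> L (opoly L i * opoly L i) = 1" for i
    using opoly_normalized[of i] by blast
  let ?c = "L (X * opoly L k * opoly_prev L k)"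
  have "L (residual L k * opoly L m) = L (X * opoly L k * opoly L m)
      - jac_a L k * L (opoly L k * opoly L m) - ?c * L (opoly_prev L k * opoly L m)"
    by (simp add: residual_def lanczos_step_def jac_a_def left_diff_distrib L_diff L_smult)
  also have "\<dots> = 0"
  proof (cases "m = k")
    case True
    have "L (opoly_prev L k * opoly L k) = 0"
      using orth[of "k - 1" k] by (cases k) auto
    then show ?thesis using True self[of k] by (auto simp: jac_a_def)
  next
    case False
    then have m: "m < k" using less.prems n by simp
    show ?thesis
    proof (cases "Suc m = k")
      case True
      then show ?thesis
        using self[of m] orth[of k m] m by auto
    next
      case False
      then have m2: "Suc m < k" using m by simp
      have 1: "L (X * opoly L k * opoly L m) = L (X * opoly L m * opoly L k)"
        by (simp add: ac_simps)
      have 2: "L (opoly_prev L m * opoly L k) = 0"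
        using orth[of "m - 1" k] m by (cases m) auto
      obtain l where l: "k = Suc l" using m by (cases k) auto
      have 3: "L (opoly L m * opoly L k) = 0" "L (opoly L (Suc m) * opoly L k) = 0"
        "L (opoly L k * opoly L m) = 0" "L (opoly_prev L k * opoly L m) = 0"
        using orth[of m k] orth[of "Suc m" k] orth[of k m] orth[of l m] m m2 l
        by auto
      show ?thesis
        unfolding 1 L_X_opoly_aux[of m "opoly L k"] using 2 3 by simp
    qed
  qed
  finally show ?case
    unfolding n opoly_Suc by (simp add: L_smult)
qed

lemma opoly_orthonormal:
  "L (opoly L m * opoly L n) = (if m = n \<and> opoly L n \<noteq> 0 then 1 else 0)"
  using opoly_orthogonal[of m n] opoly_orthogonal[of n m] opoly_normalized[of n]
  by (cases m n rule: linorder_cases) (auto simp: mult.commute)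

lemma L_X_opoly_prev: "L (X * opoly L n * opoly_prev L n) = jac_b L n"
proof (cases n)
  case (Suc k)
  have "L (X * opoly L n * opoly L k) = L (X * opoly L k * opoly L n)" by (simp add: ac_simps)
  also have "\<dots> = jac_b L n * L (opoly L n * opoly L n)"
  proof -
    have "L (opoly L k * opoly L n) = 0" "L (opoly_prev L k * opoly L n) = 0"
      using Suc opoly_orthonormal[of k n] opoly_orthonormal[of "k - 1" n] by (cases k; simp)+
    then show ?thesis using L_X_opoly_aux[of k "opoly L n"] Suc by simp
  qed
  also have "\<dots> = jac_b L n"
    using opoly_eq_0_iff[of k] Suc by (auto simp: opoly_orthonormal)
  finally show ?thesis using Suc by simp
qed simp

lemma L_X_opoly:
  "L (X * opoly L n * q) = jac_b L (Suc n) * L (opoly L (Suc n) * q) + jac_a L n * L (opoly L n * q)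
      + jac_b L n * L (opoly_prev L n * q)"
  using L_X_opoly_aux[of n q] by (simp add: L_X_opoly_prev)

lemma residual_eq: "residual L n = X * opoly L n - smult (jac_a L n) (opoly L n) - smult (jac_b L n) (opoly_prev L n)"
  using L_X_opoly_prev[of n] by (simp add: residual_def lanczos_step_def jac_a_def)

text \<open>The matrix of multiplication by $x$ in the basis $p_n$ is the Jacobi matrix; rows and columns of
vanishing $p_n$ are zero, in agreement with the convention for entries outside a finite matrix.\<close>

lemma jacobi_entry:
  "L (X * opoly L i * opoly L j) =
    (if i = j then jac_a L i else if j = Suc i then jac_b L j else if i = Suc j then jac_b L i else 0)"
proof -
  have z: "jac_b L (Suc i) = 0" if "opoly L (Suc i) = 0" for i
    using that opoly_eq_0_iff by simp
  have "jac_a L i = 0" if "opoly L i = 0"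
    using that by (simp add: jac_a_def)
  moreover have "L (opoly_prev L i * opoly L j) = (if i = Suc j \<and> opoly L j \<noteq> 0 then 1 else 0)"
    by (cases i) (auto simp: opoly_orthonormal)
  moreover have "jac_b L i = 0" if "i = Suc j" "opoly L j = 0"
    using that z opoly_eq_0_Suc by simp
  ultimately show ?thesis
    using z unfolding L_X_opoly opoly_orthonormal by auto
qed

lemma L_sum: "L (sum f A) = (\<Sum>x\<in>A. L (f x))"
  by (induction A rule: infinite_finite_induct) (auto simp: L_add)

text \<open>Both parts are proved together, since each polynomial is a positive multiple of the preceding
residual, whose leading term comes from \<open>X * opoly L n\<close>.\<close>

lemma degree_opoly:
  "opoly L n \<noteq> 0 \<Longrightarrow> degree (opoly L n) = n \<and> lead_coeff (opoly L n) > 0"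
  and degree_residual: "opoly L n \<noteq> 0 \<Longrightarrow> degree (residual L n) = Suc n \<and> lead_coeff (residual L n) > 0"
proof -
  have prev: "degree (residual L n) = Suc n \<and> lead_coeff (residual L n) > 0"
    if "\<And>m. m \<le> n \<Longrightarrow> degree (opoly L m) = m \<and> lead_coeff (opoly L m) > 0" for n
  proof -
    let ?p = "opoly L n"
    let ?r = "- smult (jac_a L n) ?p - smult (jac_b L n) (opoly_prev L n)"
    have p: "degree ?p = n" "lead_coeff ?p > 0" using that[of n] by auto
    then have p0: "?p \<noteq> 0" by auto
    have "degree (opoly_prev L n) \<le> n" using that[of "n - 1"] by (cases n) auto
    then have r: "degree ?r \<le> n"
      using p by (intro degree_diff_le) (auto intro: order.trans[OF degree_smult_le])
    have Xp: "degree (X * ?p) = Suc n" "coeff (X * ?p) (Suc n) > 0"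
      using p p0 by (auto simp: X_def degree_mult_eq)
    have eq: "residual L n = X * ?p + ?r" by (simp add: residual_eq)
    have "degree (residual L n) = Suc n"
      unfolding eq using r Xp by (subst degree_add_eq_left) auto
    moreover have "coeff ?r (Suc n) = 0" using r by (intro coeff_eq_0) simp
    then have "coeff (residual L n) (Suc n) > 0"
      unfolding eq coeff_add using Xp by simp
    ultimately show ?thesis by simp
  qed
  have main: "\<forall>m\<le>n. degree (opoly L m) = m \<and> lead_coeff (opoly L m) > 0" if "opoly L n \<noteq> 0" for n
    using that
  proof (induction n)
    case (Suc n)
    then have IH: "\<forall>m\<le>n. degree (opoly L m) = m \<and> lead_coeff (opoly L m) > 0"
      using opoly_eq_0_Suc by blast
    have b: "jac_b L (Suc n) > 0"
      using Suc.prems opoly_eq_0_iff[of n] jac_b_nonneg[of "Suc n"] by auto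
    then show ?case
    proof -
      have "degree (residual L n) = Suc n \<and> lead_coeff (residual L n) > 0" using IH by (intro prev) auto
      then show ?thesis using IH b by (auto simp: le_Suc_eq opoly_Suc)
    qed
  qed simp
  show "opoly L n \<noteq> 0 \<Longrightarrow> degree (opoly L n) = n \<and> lead_coeff (opoly L n) > 0"
    using main by blast
  show "opoly L n \<noteq> 0 \<Longrightarrow> degree (residual L n) = Suc n \<and> lead_coeff (residual L n) > 0"
    using main prev by blast
qed

text \<open>The orthonormal polynomials of index at most \<open>k\<close> span the polynomials of degree at most \<open>k\<close>, up to
null vectors. The statement is linear in \<open>f\<close>, true for $f = p_i$ by orthonormality, and stable
under multiplication by $x$ when \<open>k\<close> grows by one because of the three-term recurrence; this
covers all polynomials.\<close>

lemma parseval: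
  "degree f \<le> k \<Longrightarrow> L (f * q) = (\<Sum>i\<le>k. L (f * opoly L i) * L (opoly L i * q))"
proof (induction k arbitrary: f q)
  case 0
  then obtain c where "f = [:c:]" using degree_eq_zeroE by blast
  then have "f = smult c 1" by simp
  then show ?case by (simp only: L_smult mult_smult_left atMost_0) (simp add: L_1)
next
  case (Suc k)
  obtain c g where f: "f = pCons c g" using pCons_cases by blast
  then have f': "f = smult c 1 + X * g" by (simp add: X_def)
  have g: "degree g \<le> k" using Suc.prems f by (auto split: if_splits)
  let ?e = "\<lambda>f q. \<Sum>i\<le>Suc k. L (f * opoly L i) * L (opoly L i * q)"
  \<comment> \<open>The orthonormal polynomials themselves satisfy the identity, those that vanish included.\<close>
  have P: "?e (opoly L i) q = L (opoly L i * q)" if "i \<le> Suc k" for i q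
  proof -
    have "?e (opoly L i) q = (\<Sum>l\<le>Suc k. if l = i then L (opoly L i * q) else 0)"
      by (intro sum.cong) (auto simp: opoly_orthonormal)
    then show ?thesis using that by simp
  qed
  have XP: "?e (X * opoly L i) q = L (X * opoly L i * q)" if "i \<le> k" for i q
  proof -
    have prev: "?e (opoly_prev L i) q = L (opoly_prev L i * q)"
      using P[of "i - 1"] that by (cases i) auto
    have "?e (X * opoly L i) q = jac_b L (Suc i) * ?e (opoly L (Suc i)) q
        + jac_a L i * ?e (opoly L i) q + jac_b L i * ?e (opoly_prev L i) q"
      unfolding L_X_opoly by (simp only: sum_distrib_left distrib_right sum.distrib mult.assoc)
    also have "\<dots> = L (X * opoly L i * q)"
      using P[of "Suc i" q] P[of i q] that unfolding prev L_X_opoly by simp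
    finally show ?thesis .
  qed
  have "L (X * g * q) = L (g * (X * q))" by (simp add: ac_simps)
  also have "\<dots> = (\<Sum>i\<le>k. L (g * opoly L i) * L (X * opoly L i * q))"
    by (subst Suc.IH[OF g]) (simp add: ac_simps)
  also have "\<dots> = (\<Sum>i\<le>k. L (g * opoly L i) * ?e (X * opoly L i) q)"
    using XP by (intro sum.cong) auto
  also have "\<dots> = (\<Sum>l\<le>Suc k. (\<Sum>i\<le>k. L (g * opoly L i) * L (X * opoly L i * opoly L l)) * L (opoly L l * q))"
    unfolding sum_distrib_left sum_distrib_right mult.assoc by (rule sum.swap)
  also have "\<dots> = (\<Sum>l\<le>Suc k. L (g * (X * opoly L l)) * L (opoly L l * q))"
  proof (intro sum.cong refl arg_cong2[where f = "(*)"])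
    fix l
    show "(\<Sum>i\<le>k. L (g * opoly L i) * L (X * opoly L i * opoly L l)) = L (g * (X * opoly L l))"
      by (subst Suc.IH[OF g]) (simp add: ac_simps)
  qed
  also have "\<dots> = ?e (X * g) q" by (simp add: ac_simps)
  finally have Xg: "L (X * g * q) = ?e (X * g) q" .
  have one: "L (1 * q) = ?e 1 q" using P[of 0 q] by simp
  have "L (f * q) = c * L (1 * q) + L (X * g * q)"
    unfolding f' distrib_right by (simp only: L_add L_smult mult_smult_left)
  also have "\<dots> = (\<Sum>i\<le>Suc k. (c * L (1 * opoly L i) + L (X * g * opoly L i)) * L (opoly L i * q))"
    unfolding one Xg by (simp only: sum_distrib_left distrib_right sum.distrib mult.assoc)
  also have "\<dots> = ?e f q"
    unfolding f' by (simp only: distrib_right L_add L_smult mult_smult_left)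
  finally show ?case .
qed

lemma L_opoly_eq_0: "degree f < n \<Longrightarrow> L (f * opoly L n) = 0"
  using parseval[of f "degree f" "opoly L n"] by (auto simp: opoly_orthonormal intro!: sum.neutral)

text \<open>A nonzero $p_n$ is, up to a factor and terms of lower degree, equal to any \<open>f\<close> of degree \<open>n\<close>, so
$L(f p_n) \neq 0$. This is impossible for a null vector \<open>f\<close>.\<close>

lemma opoly_degree_null:
  assumes "f \<noteq> 0" "L (f * f) = 0"
  shows "opoly L (degree f) = 0"
proof (rule ccontr)
  let ?n = "degree f" and ?p = "opoly L (degree f)"
  assume nz: "?p \<noteq> 0"
  then have p: "degree ?p = ?n" "lead_coeff ?p > 0" using degree_opoly[of ?n] by auto
  \<comment> \<open>Subtracting \<open>c\<close> times \<open>?p\<close> cancels the leading term of \<open>f\<close>.\<close>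
  define c where "c = lead_coeff f / lead_coeff ?p"
  define r where "r = f - smult c ?p"
  have c: "c \<noteq> 0" using assms p by (auto simp: c_def)
  have "coeff r ?n = 0" using p by (simp add: r_def c_def)
  moreover have "degree r \<le> ?n" using p by (auto simp: r_def intro!: degree_diff_le order.trans[OF degree_smult_le])
  ultimately have "r = 0 \<or> degree r < ?n"
    by (metis leading_coeff_0_iff le_neq_implies_less)
  then have "L (r * ?p) = 0" using L_opoly_eq_0 by auto
  moreover have "L (f * ?p) = 0" using assms(2) L_null by blast
  moreover have "L (r * ?p) = L (f * ?p) - c * L (?p * ?p)"
    by (simp add: r_def left_diff_distrib L_diff L_smult)
  ultimately show False using nz c by (simp add: opoly_orthonormal)
qed

end

section \<open>Measures on the interval and their Jacobi matrices\<close>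

definition moment :: "real measure \<Rightarrow> real poly \<Rightarrow> real" where
  "moment \<nu> p = (\<integral>x. poly p x \<partial>\<nu>)"

lemma borel_measurable_poly [measurable]: "poly (p :: real poly) \<in> borel_measurable borel"
  by (intro borel_measurable_continuous_onI continuous_intros)

lemma integrable_poly:
  assumes "\<nu> \<in> prob_measures"
  shows "integrable \<nu> (poly p)"
proof -
  interpret prob_space \<nu> using assms by (simp add: prob_measures_def)
  have [measurable_cong]: "sets \<nu> = sets borel" using assms by (simp add: prob_measures_def)
  have "compact (poly p ` {-1..1})"
    by (intro compact_continuous_image continuous_intros) auto
  then obtain B where B: "\<And>x. x \<in> {-1..1} \<Longrightarrow> norm (poly p x) \<le> B"
    by (meson bounded_iff compact_imp_bounded imageI)
  show ?thesis
  proof (rule integrable_const_bound[of _ B])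
    show "AE x in \<nu>. norm (poly p x) \<le> B"
      using prob_measures_AE[OF assms] by eventually_elim (use B in auto)
  qed measurable
qed

text \<open>The complement of the support is a union of open null sets, which the Lindelof property reduces to
a countable union.\<close>

lemma AE_msupport:
  assumes "\<nu> \<in> prob_measures"
  shows "AE x in \<nu>. x \<in> msupport \<nu>"
proof -
  interpret prob_space \<nu> using assms by (simp add: prob_measures_def)
  have sets[simp]: "sets \<nu> = sets borel" using assms by (simp add: prob_measures_def)
  define F where "F = {U. open U \<and> measure \<nu> U = 0}"
  obtain F' where F': "F' \<subseteq> F" "countable F'" "\<Union>F' = \<Union>F"
    using Lindelof[of F] by (auto simp: F_def)
  have "(\<Union>U\<in>F'. U) \<in> null_sets \<nu>"
    using F' by (intro null_sets_UN') (auto simp: F_def null_sets_def emeasure_eq_measure)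
  then have null: "\<Union>F \<in> null_sets \<nu>" using F' by simp
  have sub: "x \<in> msupport \<nu>" if "x \<notin> \<Union>F" for x
    using that by (auto simp: F_def msupport_def zero_less_measure_iff)
  show ?thesis
    by (rule AE_I'[OF null]) (use sub in auto)
qed

lemma moment_functional_moment:
  assumes "\<nu> \<in> prob_measures"
  shows "moment_functional (moment \<nu>)"
proof -
  interpret prob_space \<nu> using assms by (simp add: prob_measures_def)
  note [simp] = integrable_poly[OF assms]
  show ?thesis
    by unfold_locales (auto simp: moment_def prob_space)
qed

lemma moment_square_eq_0_iff:
  assumes "\<nu> \<in> prob_measures"
  shows "moment \<nu> (p * p) = 0 \<longleftrightarrow> (\<forall>x\<in>msupport \<nu>. poly p x = 0)"
proof
  interpret prob_space \<nu> using assms by (simp add: prob_measures_def)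
  have [measurable_cong]: "sets \<nu> = sets borel" using assms by (simp add: prob_measures_def)
  assume 0: "moment \<nu> (p * p) = 0"
  have "AE x in \<nu>. poly (p * p) x = 0"
    using 0 by (subst (asm) moment_def, subst (asm) integral_nonneg_eq_0_iff_AE)
      (auto intro: integrable_poly[OF assms])
  then have AE: "AE x in \<nu>. poly p x = 0" by simp
  show "\<forall>x\<in>msupport \<nu>. poly p x = 0"
  proof (intro ballI, rule ccontr)
    fix x assume x: "x \<in> msupport \<nu>" "poly p x \<noteq> 0"
    define U where "U = {y. poly p y \<noteq> 0}"
    have "open U" unfolding U_def by (intro open_Collect_neq continuous_intros)
    then have "measure \<nu> U > 0" using x by (auto simp: msupport_def U_def)
    moreover have "measure \<nu> U = measure \<nu> {}"
      using AE \<open>open U\<close> assms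
      by (intro finite_measure_eq_AE) (auto simp: U_def prob_measures_def)
    ultimately show False by simp
  qed
next
  assume *: "\<forall>x\<in>msupport \<nu>. poly p x = 0"
  have "(\<integral>x. poly (p * p) x \<partial>\<nu>) = (\<integral>x. 0 \<partial>\<nu>)"
    using AE_msupport[OF assms] assms
    by (intro integral_cong_AE) (use * in \<open>auto simp: prob_measures_def measurable_def\<close>)
  then show "moment \<nu> (p * p) = 0" by (simp add: moment_def)
qed

text \<open>The recurrence breaks down exactly when the degree reaches the number of support points: the
polynomial with a simple zero at each support point is a null vector, and a nonzero polynomial
of smaller degree cannot vanish on the whole support.\<close>

lemma opoly_moment_nonzero_iff:
  assumes "\<nu> \<in> prob_measures"
  shows "opoly (moment \<nu>) n \<noteq> 0 \<longleftrightarrow> enat n < supp_size \<nu>"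
proof
  interpret moment_functional "moment \<nu>" by (rule moment_functional_moment) fact
  assume nz: "opoly (moment \<nu>) n \<noteq> 0"
  show "enat n < supp_size \<nu>"
  proof (cases "finite (msupport \<nu>)")
    case True
    define f where "f = (\<Prod>x\<in>msupport \<nu>. [:- x, 1:])"
    have "f \<noteq> 0" using True by (simp add: f_def)
    moreover have "degree f = card (msupport \<nu>)"
      unfolding f_def by (subst degree_prod_sum_eq) auto
    moreover have "moment \<nu> (f * f) = 0"
      unfolding moment_square_eq_0_iff[OF assms] using True by (auto simp: f_def poly_prod)
    ultimately have "opoly (moment \<nu>) (card (msupport \<nu>)) = 0"
      using opoly_degree_null[of f] by simp
    then have "\<not> card (msupport \<nu>) \<le> n" using nz opoly_eq_0_mono by blast
    then show ?thesis using True by (simp add: supp_size_def)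
  qed (simp add: supp_size_def)
next
  interpret moment_functional "moment \<nu>" by (rule moment_functional_moment) fact
  show "enat n < supp_size \<nu> \<Longrightarrow> opoly (moment \<nu>) n \<noteq> 0"
  proof (induction n)
    case (Suc n)
    then have nz: "opoly (moment \<nu>) n \<noteq> 0"
      by (metis Suc_ile_eq order_less_imp_le)
    let ?r = "residual (moment \<nu>) n"
    have r: "degree ?r = Suc n" "?r \<noteq> 0" using degree_residual[OF nz] by auto
    show ?case
    proof
      assume "opoly (moment \<nu>) (Suc n) = 0"
      then have "moment \<nu> (?r * ?r) = 0" by (simp add: L_residual)
      then have sub: "msupport \<nu> \<subseteq> {x. poly ?r x = 0}"
        unfolding moment_square_eq_0_iff[OF assms] by auto
      then have "finite (msupport \<nu>)"
        using poly_roots_finite[OF r(2)] finite_subset by blast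
      moreover have "card (msupport \<nu>) \<le> Suc n"
        using card_mono[OF poly_roots_finite[OF r(2)] sub] card_poly_roots_bound[OF r(2)] r(1) by simp
      ultimately show False using Suc.prems by (simp add: supp_size_def)
    qed
  qed simp
qed

text \<open>On the support, the residual equals $b_{n+1}p_{n+1}$ even when $b_{n+1} = 0$, since it is a null
vector; this is the recurrence in the last row of a finite Jacobi matrix.\<close>

lemma opolys_jacobi_data:
  assumes "\<nu> \<in> prob_measures"
  defines "L \<equiv> moment \<nu>"
  shows "orthonormal_polys \<nu> (opoly L)" and "recurrence_coeffs \<nu> (opoly L) (jac_a L) (jac_b L)"
proof -
  interpret moment_functional L unfolding L_def by (rule moment_functional_moment) fact
  have nz: "opoly L n \<noteq> 0 \<longleftrightarrow> enat n < supp_size \<nu>" for n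
    unfolding L_def by (rule opoly_moment_nonzero_iff) fact
  show "orthonormal_polys \<nu> (opoly L)"
    unfolding orthonormal_polys_def
  proof (intro conjI allI impI)
    fix n assume "enat n < supp_size \<nu>"
    then show "degree (opoly L n) = n" "lead_coeff (opoly L n) > 0"
      using degree_opoly[of n] nz by auto
  next
    fix m n assume "enat m < supp_size \<nu>" "enat n < supp_size \<nu>"
    then show "(\<integral>s. poly (opoly L m) s * poly (opoly L n) s \<partial>\<nu>) = (if m = n then 1 else 0)"
      using opoly_orthonormal[of m n] nz by (simp add: L_def moment_def)
  qed
  have rec: "s * poly (opoly L n) s = poly (residual L n) s + jac_a L n * poly (opoly L n) s
      + jac_b L n * poly (opoly_prev L n) s" for n s
    by (simp add: residual_eq X_def)
  have prev: "jac_b L n * poly (opoly_prev L n) s = (if n = 0 then 0 else jac_b L n * poly (opoly L (n - 1)) s)"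
    for n s by (cases n) auto
  have residual: "poly (residual L n) s = jac_b L (Suc n) * poly (opoly L (Suc n)) s"
    if "enat (Suc n) < supp_size \<nu> \<or> s \<in> msupport \<nu>" for n s
  proof (cases "jac_b L (Suc n) = 0")
    case True
    then have "moment \<nu> (residual L n * residual L n) = 0"
      using jac_b_Suc_sq[of n] by (simp add: L_def)
    moreover have "\<not> enat (Suc n) < supp_size \<nu>"
      using True nz[of "Suc n"] opoly_eq_0_iff[of n] by blast
    ultimately show ?thesis
      using True that moment_square_eq_0_iff[OF assms(1)] by auto
  qed (simp add: opoly_Suc)
  have "jac_b L j = 0" if "supp_size \<nu> \<le> enat j" for j
    using that nz[of j] opoly_eq_0_iff[of "j - 1"] by (cases j) auto
  then show "recurrence_coeffs \<nu> (opoly L) (jac_a L) (jac_b L)"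
    unfolding recurrence_coeffs_def using rec prev residual by auto
qed

text \<open>Integrating the recurrence against $p_n$ expresses $a_n$ through $p_n$. Then $b_{n+1}p_{n+1}$ is
determined by the recurrence, hence so is its norm $b_{n+1}$, with a positive sign because of the
leading coefficients. By induction all data agree with the ones constructed above.\<close>

lemma jacobi_data_unique:
  assumes \<nu>: "\<nu> \<in> prob_measures"
    and p: "orthonormal_polys \<nu> p" and rec: "recurrence_coeffs \<nu> p a b"
    and n: "enat n < supp_size \<nu>"
  defines "L \<equiv> moment \<nu>"
  shows "p n = opoly L n \<and> a n = jac_a L n \<and> b n = jac_b L n"
proof -
  interpret moment_functional L unfolding L_def by (rule moment_functional_moment) fact
  have orth: "L (p m * p n) = (if m = n then 1 else 0)"
    if "enat m < supp_size \<nu>" "enat n < supp_size \<nu>" for m n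
    using p that by (simp add: orthonormal_polys_def L_def moment_def)
  have lead: "degree (p n) = n" "lead_coeff (p n) > 0" if "enat n < supp_size \<nu>" for n
    using p that by (auto simp: orthonormal_polys_def)
  define prev where "prev k = (if k = 0 then 0 else p (k - 1))" for k
  have a: "a n = L (X * p n * p n)" if n: "enat n < supp_size \<nu>" for n
  proof -
    let ?q = "smult (b (Suc n)) (p (Suc n) * p n) + smult (a n) (p n * p n) + smult (b n) (prev n * p n)"
    have "L (X * p n * p n) = L ?q"
      unfolding L_def moment_def
    proof (intro integral_cong_AE)
      show "AE s in \<nu>. poly (X * p n * p n) s = poly ?q s"
        using AE_msupport[OF \<nu>]
      proof eventually_elim
        case (elim s)
        have "s * poly (p n) s = b (Suc n) * poly (p (Suc n)) s + a n * poly (p n) s + b n * poly (prev n) s"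
          using rec elim n by (auto simp: recurrence_coeffs_def prev_def)
        then have "s * poly (p n) s * poly (p n) s =
            (b (Suc n) * poly (p (Suc n)) s + a n * poly (p n) s + b n * poly (prev n) s) * poly (p n) s"
          by simp
        then show ?case by (simp add: X_def algebra_simps)
      qed
    qed (use \<nu> in \<open>auto simp: prob_measures_def measurable_def\<close>)
    moreover have "b (Suc n) * L (p (Suc n) * p n) = 0"
    proof (cases "enat (Suc n) < supp_size \<nu>")
      case True
      then show ?thesis using orth n by simp
    next
      case False
      then show ?thesis using rec by (simp add: recurrence_coeffs_def not_less)
    qed
    moreover have "L (prev n * p n) = 0"
    proof (cases n)
      case (Suc m)
      then have "enat m < supp_size \<nu>" using n by (metis Suc_ile_eq order_less_imp_le)
      then show ?thesis using orth[of m n] n Suc by (simp add: prev_def)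
    qed (simp add: prev_def)
    ultimately show ?thesis using orth[of n n] n by (simp add: L_add L_smult)
  qed
  have "p n = opoly L n \<and> prev n = opoly_prev L n \<and> b n = jac_b L n"
    using n
  proof (induction n)
    case 0
    obtain c where c: "p 0 = [:c:]" using lead[OF 0] degree_eq_zeroE by blast
    have "L (smult (c * c) 1) = 1" using orth[OF 0 0] c by simp
    then have "c * c = 1" by (simp only: L_smult L_1)
    moreover have "c > 0" using lead[OF 0] c by simp
    ultimately have "c = 1" using square_eq_1_iff[of c] by auto
    then show ?case using rec c by (simp add: prev_def recurrence_coeffs_def)
  next
    case (Suc n)
    then have n: "enat n < supp_size \<nu>" by (metis Suc_ile_eq order_less_imp_le)
    note IH = Suc.IH[OF n]
    have an: "a n = jac_a L n" using a[OF n] IH by (simp add: jac_a_def)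
    have eq: "smult (b (Suc n)) (p (Suc n)) = residual L n"
    proof (rule poly_ext)
      fix s
      have "s * poly (p n) s = b (Suc n) * poly (p (Suc n)) s + a n * poly (p n) s + b n * poly (prev n) s"
        using rec n Suc.prems by (auto simp: recurrence_coeffs_def prev_def)
      then show "poly (smult (b (Suc n)) (p (Suc n))) s = poly (residual L n) s"
        using IH an by (simp add: residual_eq X_def)
    qed
    have nz: "opoly L n \<noteq> 0" "opoly L (Suc n) \<noteq> 0"
      using opoly_moment_nonzero_iff[OF \<nu>] n Suc.prems by (auto simp: L_def)
    have "lead_coeff (residual L n) = b (Suc n) * lead_coeff (p (Suc n))"
      using eq by (metis lead_coeff_smult)
    then have "b (Suc n) * lead_coeff (p (Suc n)) > 0" using degree_residual[OF nz(1)] by metis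
    then have pos: "b (Suc n) > 0" using lead[OF Suc.prems] by (simp add: zero_less_mult_iff)
    have "(jac_b L (Suc n))\<^sup>2 = (b (Suc n))\<^sup>2"
      unfolding jac_b_Suc_sq eq[symmetric]
      using orth[OF Suc.prems Suc.prems] by (simp add: L_smult power2_eq_square)
    then have b: "b (Suc n) = jac_b L (Suc n)"
      using pos jac_b_nonneg[of "Suc n"] by (simp add: power2_eq_iff_nonneg)
    then have "p (Suc n) = opoly L (Suc n)"
      using pos eq unfolding opoly_Suc by (simp flip: eq)
    then show ?case using IH b by (simp add: prev_def)
  qed
  then show ?thesis using a[OF n] by (simp add: jac_a_def)
qed

lemma jacobi_eq:
  assumes "\<nu> \<in> prob_measures"
  defines "L \<equiv> moment \<nu>"
  shows "jacobi \<nu> = tridiagonal (supp_size \<nu>) (jac_a L) (jac_b L)"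
  unfolding jacobi_def
proof (rule the_equality)
  show "\<exists>p a b. orthonormal_polys \<nu> p \<and> recurrence_coeffs \<nu> p a b \<and>
      tridiagonal (supp_size \<nu>) (jac_a L) (jac_b L) = tridiagonal (supp_size \<nu>) a b"
    using opolys_jacobi_data[OF assms(1)] unfolding L_def by blast
next
  fix J assume "\<exists>p a b. orthonormal_polys \<nu> p \<and> recurrence_coeffs \<nu> p a b \<and> J = tridiagonal (supp_size \<nu>) a b"
  then obtain p a b where *: "orthonormal_polys \<nu> p" "recurrence_coeffs \<nu> p a b"
    and J: "J = tridiagonal (supp_size \<nu>) a b" by blast
  show "J = tridiagonal (supp_size \<nu>) (jac_a L) (jac_b L)"
    unfolding J tridiagonal_def mk_sqmat_def L_def
    using jacobi_data_unique[OF assms(1) *] by (intro arg_cong2[where f = Sqmat] ext) auto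
qed

lemma msize_jacobi: "\<nu> \<in> prob_measures \<Longrightarrow> msize (jacobi \<nu>) = supp_size \<nu>"
  by (simp add: jacobi_eq tridiagonal_def mk_sqmat_def)

lemma entry_jacobi:
  assumes "\<nu> \<in> prob_measures"
  defines "L \<equiv> moment \<nu>"
  shows "entry (jacobi \<nu>) i j = L (X * opoly L i * opoly L j)"
proof -
  interpret moment_functional L unfolding L_def by (rule moment_functional_moment) fact
  have nz: "opoly L n \<noteq> 0 \<longleftrightarrow> enat n < supp_size \<nu>" for n
    unfolding L_def by (rule opoly_moment_nonzero_iff) fact
  show ?thesis
  proof (cases "enat i < supp_size \<nu> \<and> enat j < supp_size \<nu>")
    case True
    then show ?thesis
      using jacobi_entry[of i j] unfolding jacobi_eq[OF assms(1)]
      by (simp add: tridiagonal_def mk_sqmat_def L_def)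
  next
    case False
    then have "opoly L i = 0 \<or> opoly L j = 0" using nz by blast
    then show ?thesis
      using False unfolding jacobi_eq[OF assms(1)]
      by (auto simp: tridiagonal_def mk_sqmat_def)
  qed
qed

text \<open>The entries that row \<open>k\<close> contributes to the output. A zero off-diagonal entry marks the end of a
finite matrix.\<close>

definition jacobi_row :: "(nat \<Rightarrow> real) \<Rightarrow> (nat \<Rightarrow> real) \<Rightarrow> nat \<Rightarrow> real list" where
  "jacobi_row a b k = (if k = 0 then [a 0] else if b k = 0 then [] else [b k, a k])"

text \<open>Rows from the number of support points on are empty, so rows may be listed up to \<open>n\<close> whatever the
size of the matrix is.\<close>

lemma entry_list_truncation_jacobi:
  assumes "\<nu> \<in> prob_measures"
  defines "L \<equiv> moment \<nu>"
  shows "entry_list (truncation n (jacobi \<nu>)) = concat (map (jacobi_row (jac_a L) (jac_b L)) [0..<n])"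
proof -
  interpret moment_functional L unfolding L_def by (rule moment_functional_moment) fact
  let ?K = "supp_size \<nu>" and ?row = "jacobi_row (jac_a L) (jac_b L)"
  have nz: "opoly L k \<noteq> 0 \<longleftrightarrow> enat k < ?K" for k
    unfolding L_def by (rule opoly_moment_nonzero_iff) fact
  have K: "enat 0 < ?K" using nz[of 0] by simp
  have b: "jac_b L k \<noteq> 0 \<longleftrightarrow> enat k < ?K" if "k > 0" for k
    using that nz[of k] opoly_eq_0_iff[of "k - 1"] by simp
  obtain m where m: "min (enat n) ?K = enat m"
    using enat_ile[of "min (enat n) ?K" n] by auto
  then have m1: "m \<le> n" by (metis enat_ord_simps(1) min.cobounded1)
  have m2: "enat k < ?K" if "k < m" for k
    using that m by (metis enat_ord_simps(2) min_less_iff_conj)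
  have m3: "\<not> enat k < ?K" if "m \<le> k" "k < n" for k
    using that m by (metis enat_ord_simps(2) min_less_iff_conj not_le)
  have e: "entry (truncation n (jacobi \<nu>)) i j = entry (jacobi \<nu>) i j" if "i < m" "j < m" for i j
    using that m by (simp add: truncation_def mk_sqmat_def msize_jacobi[OF assms(1)])
  have size: "msize (truncation n (jacobi \<nu>)) = enat m"
    using m by (simp add: truncation_def mk_sqmat_def msize_jacobi[OF assms(1)])
  have "entry_list (truncation n (jacobi \<nu>)) = concat (map ?row [0..<m])"
    unfolding entry_list_def size the_enat.simps
  proof (intro arg_cong[where f = concat] map_cong refl)
    fix i assume "i \<in> set [0..<m]"
    then have i: "i < m" by simp
    have "jac_b L i \<noteq> 0" if "i > 0" using b[OF that] m2[OF i] by blast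
    then show "(if i = 0 then [entry (truncation n (jacobi \<nu>)) 0 0]
        else [entry (truncation n (jacobi \<nu>)) (i - 1) i, entry (truncation n (jacobi \<nu>)) i i]) = ?row i"
      using i e[of 0 0] e[of "i - 1" i] e[of i i] entry_jacobi[OF assms(1)]
        jacobi_entry[of "i - 1" i] jacobi_entry[of i i]
      by (auto simp: jacobi_row_def L_def)
  qed
  moreover have "concat (map ?row [m..<n]) = []"
  proof -
    have "?row k = []" if "k \<in> set [m..<n]" for k
    proof -
      have "\<not> enat k < ?K" using m3 that by simp
      moreover from this have "k > 0" using K by (cases k) auto
      ultimately show ?thesis using b[of k] by (simp add: jacobi_row_def)
    qed
    then show ?thesis by simp
  qed
  moreover have "[0..<n] = [0..<m] @ [m..<n]" using m1 upt_add_eq_append[of 0 m "n - m"] by simp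
  ultimately show ?thesis by simp
qed

section \<open>The convolution in the product basis\<close>

text \<open>\<open>inner_moment g p\<close> is, as a polynomial in \<open>\<beta>\<close>, the integral of $p(\phi(\beta,s))\,g(s)$ over \<open>s\<close>.
Working with it replaces polynomials in two variables by two applications of the theory in one.\<close>

locale convolution =
  S: moment_functional LS + E: moment_functional LE + B: moment_functional LB
  for LS LE LB :: "real poly \<Rightarrow> real" +
  fixes \<delta> :: real
  fixes inner_moment :: "real poly \<Rightarrow> real poly \<Rightarrow> real poly"
  assumes poly_inner_moment: "poly (inner_moment g p) \<beta> = LE (pcompose p [:(1 - \<delta>) * \<beta>, \<delta>:] * g)"
    and degree_inner_moment: "degree (inner_moment g p) \<le> degree p"
    and LB: "LB p = LS (inner_moment 1 p)"
begin

text \<open>The coefficient of $p(\phi(\beta,s))$ at $p_i(\sigma;\beta)\,p_j(\eta;s)$. Taking it as an inner product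
makes it 0 at vanishing basis functions, where a coefficient would not be determined.\<close>

definition coef :: "real poly \<Rightarrow> nat \<Rightarrow> nat \<Rightarrow> real" where
  "coef p i j = LS (opoly LS i * inner_moment (opoly LE j) p)"

lemma inner_moment_diff: "inner_moment g (p - q) = inner_moment g p - inner_moment g q"
  by (rule poly_ext) (simp add: poly_inner_moment pcompose_diff left_diff_distrib E.L_diff)

lemma inner_moment_smult: "inner_moment g (smult c p) = smult c (inner_moment g p)"
  by (rule poly_ext) (simp add: poly_inner_moment pcompose_smult E.L_smult)

lemma coef_diff: "coef (p - q) i j = coef p i j - coef q i j"
  by (simp add: coef_def inner_moment_diff right_diff_distrib S.L_diff)

lemma coef_smult: "coef (smult c p) i j = c * coef p i j"
  by (simp add: coef_def inner_moment_smult S.L_smult)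

lemma degree_compose_affine: "degree (pcompose p [:a, b:]) \<le> degree p" for p :: "real poly"
  by (rule order.trans[OF degree_pcompose_le]) simp

lemma coef_eq_0:
  assumes "degree p < i \<or> degree p < j"
  shows "coef p i j = 0"
proof (cases "degree p < i")
  case True
  then show ?thesis
    using S.L_opoly_eq_0[of "inner_moment (opoly LE j) p" i] degree_inner_moment[of "opoly LE j" p]
    by (simp add: coef_def mult.commute)
next
  case False
  then have "degree (pcompose p [:a, b:]) < j" for a b
    using assms degree_compose_affine[of p a b] by simp
  then have "inner_moment (opoly LE j) p = 0"
    using E.L_opoly_eq_0 by (intro poly_ext) (simp add: poly_inner_moment)
  then show ?thesis by (simp add: coef_def)
qed

lemma coef_one: "coef 1 i j = (if i = 0 \<and> j = 0 then 1 else 0)"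
proof -
  have "inner_moment (opoly LE j) 1 = smult (LE (opoly LE j * opoly LE 0)) 1"
    by (rule poly_ext) (simp add: poly_inner_moment pcompose_1)
  also have "\<dots> = smult (if j = 0 then 1 else 0) 1"
    by (subst E.opoly_orthonormal) simp
  finally have "coef 1 i j = (if j = 0 then 1 else 0) * LS (opoly LS i * opoly LS 0)"
    by (simp add: coef_def S.L_smult)
  then show ?thesis by (subst (asm) S.opoly_orthonormal) simp
qed

text \<open>Parseval's identity first in \<open>s\<close>, for each fixed \<open>\<beta>\<close>, and then in \<open>\<beta>\<close>.\<close>

lemma parseval_conv:
  assumes "degree p \<le> k"
  shows "LB (p * q) = (\<Sum>i\<le>k. \<Sum>j\<le>k. coef p i j * coef q i j)"
proof -
  have "inner_moment 1 (p * q) = (\<Sum>j\<le>k. inner_moment (opoly LE j) p * inner_moment (opoly LE j) q)"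
  proof (rule poly_ext)
    fix \<beta>
    have "degree (pcompose p [:(1 - \<delta>) * \<beta>, \<delta>:]) \<le> k"
      using degree_compose_affine assms order.trans by blast
    from E.parseval[OF this, of "pcompose q [:(1 - \<delta>) * \<beta>, \<delta>:]"]
    show "poly (inner_moment 1 (p * q)) \<beta> = poly (\<Sum>j\<le>k. inner_moment (opoly LE j) p * inner_moment (opoly LE j) q) \<beta>"
      by (simp add: poly_inner_moment poly_sum pcompose_mult mult.commute)
  qed
  then have "LB (p * q) = (\<Sum>j\<le>k. LS (inner_moment (opoly LE j) p * inner_moment (opoly LE j) q))"
    by (simp add: LB S.L_sum)
  also have "\<dots> = (\<Sum>j\<le>k. \<Sum>i\<le>k. coef p i j * coef q i j)"
  proof (rule sum.cong[OF refl])
    fix j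
    have "degree (inner_moment (opoly LE j) p) \<le> k" using degree_inner_moment assms order.trans by blast
    from S.parseval[OF this, of "inner_moment (opoly LE j) q"]
    show "LS (inner_moment (opoly LE j) p * inner_moment (opoly LE j) q) = (\<Sum>i\<le>k. coef p i j * coef q i j)"
      by (simp add: coef_def mult.commute)
  qed
  also have "\<dots> = (\<Sum>i\<le>k. \<Sum>j\<le>k. coef p i j * coef q i j)"
    by (rule sum.swap)
  finally show ?thesis .
qed

text \<open>Multiplying $p$ by its variable multiplies $p(\phi(\beta,s))$ by $\delta s + \bar\delta\beta$.
Symmetry moves the factor $s$ or $\beta$ to the basis function, and expanding the result with
Parseval's identity produces a row of $J_\eta$ or $J_\sigma$. The degree bound limits the sum to
$l \le k$, which is the source of the locality in the indices.\<close>

lemma coef_X: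
  assumes "degree p \<le> k"
  shows "coef (X * p) i j = (\<Sum>l\<le>k. (1 - \<delta>) * LS (X * opoly LS i * opoly LS l) * coef p l j
      + \<delta> * LE (X * opoly LE j * opoly LE l) * coef p i l)"
proof -
  let ?P = "opoly LS" and ?Q = "opoly LE"
  have "inner_moment (?Q j) (X * p) = smult \<delta> (inner_moment (X * ?Q j) p) + smult (1 - \<delta>) (X * inner_moment (?Q j) p)"
  proof (rule poly_ext)
    fix \<beta>
    let ?p = "pcompose p [:(1 - \<delta>) * \<beta>, \<delta>:]"
    have "pcompose (X * p) [:(1 - \<delta>) * \<beta>, \<delta>:] * ?Q j =
        smult \<delta> (?p * (X * ?Q j)) + smult ((1 - \<delta>) * \<beta>) (?p * ?Q j)"
      by (rule poly_ext) (simp add: pcompose_mult pcompose_pCons X_def algebra_simps)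
    then show "poly (inner_moment (?Q j) (X * p)) \<beta> =
        poly (smult \<delta> (inner_moment (X * ?Q j) p) + smult (1 - \<delta>) (X * inner_moment (?Q j) p)) \<beta>"
      by (simp only: poly_inner_moment E.L_add E.L_smult poly_add poly_smult poly_mult) (simp add: X_def)
  qed
  then have 1: "coef (X * p) i j = \<delta> * LS (?P i * inner_moment (X * ?Q j) p)
      + (1 - \<delta>) * LS (inner_moment (?Q j) p * (X * ?P i))"
    by (simp add: coef_def distrib_left S.L_add S.L_smult ac_simps)
  have "degree (inner_moment (?Q j) p) \<le> k" using degree_inner_moment assms order.trans by blast
  from S.parseval[OF this, of "X * ?P i"]
  have 2: "LS (inner_moment (?Q j) p * (X * ?P i)) = (\<Sum>l\<le>k. LS (X * ?P i * ?P l) * coef p l j)"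
    by (simp add: coef_def ac_simps)
  have "inner_moment (X * ?Q j) p = (\<Sum>l\<le>k. smult (LE (X * ?Q j * ?Q l)) (inner_moment (?Q l) p))"
  proof (rule poly_ext)
    fix \<beta>
    have "degree (pcompose p [:(1 - \<delta>) * \<beta>, \<delta>:]) \<le> k"
      using degree_compose_affine assms order.trans by blast
    from E.parseval[OF this, of "X * ?Q j"]
    show "poly (inner_moment (X * ?Q j) p) \<beta> = poly (\<Sum>l\<le>k. smult (LE (X * ?Q j * ?Q l)) (inner_moment (?Q l) p)) \<beta>"
      by (simp add: poly_inner_moment poly_sum ac_simps)
  qed
  then have "LS (?P i * inner_moment (X * ?Q j) p) = (\<Sum>l\<le>k. LE (X * ?Q j * ?Q l) * coef p i l)"
    by (simp add: sum_distrib_left S.L_sum S.L_smult coef_def)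
  with 1 2 show ?thesis
    by (simp add: sum_distrib_left sum.distrib ac_simps)
qed

lemma degree_opoly_le: "degree (opoly LB n) \<le> n"
  using B.degree_opoly[of n] by (cases "opoly LB n = 0") auto

lemma coef_residual:
  "coef (residual LB k) i j =
     (\<Sum>l\<le>Suc k. (1 - \<delta>) * LS (X * opoly LS i * opoly LS l) * coef (opoly LB k) l j
        + \<delta> * LE (X * opoly LE j * opoly LE l) * coef (opoly LB k) i l)
     - jac_a LB k * coef (opoly LB k) i j - jac_b LB k * coef (opoly LB (k - 1)) i j"
proof -
  have "jac_b LB k * coef (opoly_prev LB k) i j = jac_b LB k * coef (opoly LB (k - 1)) i j"
    by (cases k) auto
  then show ?thesis
    using coef_X[of "opoly LB k" "Suc k" i j] degree_opoly_le[of k]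
    by (simp add: B.residual_eq coef_diff coef_smult del: sum.atMost_Suc)
qed

lemma degree_residual_le: "degree (residual LB k) \<le> Suc k"
proof (cases "opoly LB k = 0")
  case True
  then show ?thesis by (simp add: residual_def lanczos_step_def)
next
  case False
  then show ?thesis using B.degree_residual[of k] by simp
qed

lemma jac_b_eq:
  "jac_b LB (Suc k) = sqrt (\<Sum>i\<le>Suc k. \<Sum>j\<le>Suc k. coef (residual LB k) i j * coef (residual LB k) i j)"
  unfolding parseval_conv[OF degree_residual_le, symmetric] B.jac_b_Suc_sq[symmetric]
  using B.jac_b_nonneg[of "Suc k"] by simp

lemma coef_opoly_Suc: "coef (opoly LB (Suc k)) i j = coef (residual LB k) i j / jac_b LB (Suc k)"
  by (simp add: opoly_Suc coef_smult field_simps)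

lemma jac_a_eq:
  "jac_a LB k = (\<Sum>i\<le>k. \<Sum>j\<le>k. \<Sum>l\<le>k. coef (opoly LB k) i j *
     ((1 - \<delta>) * LS (X * opoly LS i * opoly LS l) * coef (opoly LB k) l j
      + \<delta> * LE (X * opoly LE j * opoly LE l) * coef (opoly LB k) i l))"
  using parseval_conv[OF degree_opoly_le[of k], of "X * opoly LB k"]
  by (simp add: jac_a_def coef_X[OF degree_opoly_le] sum_distrib_left ac_simps)

end

text \<open>By induction on \<open>p\<close>: a factor $\delta s + \bar\delta\beta$ turns \<open>g\<close> into \<open>X * g\<close> in one summand
and multiplies the result by \<open>\<beta>\<close> in the other.\<close>

lemma inner_moment_exists:
  assumes "moment_functional L"
  shows "\<exists>f. degree f \<le> degree p \<and> (\<forall>\<beta>. poly f \<beta> = L (pcompose p [:(1 - \<delta>) * \<beta>, \<delta>:] * g))"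
proof (induction p arbitrary: g)
  case 0
  interpret moment_functional L by fact
  show ?case by (intro exI[of _ 0]) simp
next
  case (pCons c p)
  interpret moment_functional L by fact
  obtain f1 where f1: "degree f1 \<le> degree p" "\<And>\<beta>. poly f1 \<beta> = L (pcompose p [:(1 - \<delta>) * \<beta>, \<delta>:] * (X * g))"
    using pCons.IH[of "X * g"] by blast
  obtain f2 where f2: "degree f2 \<le> degree p" "\<And>\<beta>. poly f2 \<beta> = L (pcompose p [:(1 - \<delta>) * \<beta>, \<delta>:] * g)"
    using pCons.IH[of g] by blast
  let ?f = "[:c * L g:] + smult \<delta> f1 + smult (1 - \<delta>) (X * f2)"
  show ?case
  proof (intro exI[of _ ?f] conjI allI)
    show "degree ?f \<le> degree (pCons c p)"
    proof (cases "p = 0")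
      case True
      then have "f1 = 0" "f2 = 0" using f1 f2 by (auto intro!: poly_ext)
      then show ?thesis by simp
    next
      case False
      have "degree (X * f2) \<le> Suc (degree p)"
        using f2(1) by (auto simp: X_def degree_pCons_eq_if)
      then show ?thesis
        using False f1(1) by (intro degree_add_le) (auto intro: order.trans[OF degree_smult_le])
    qed
    fix \<beta>
    let ?p = "pcompose p [:(1 - \<delta>) * \<beta>, \<delta>:]"
    have "pcompose (pCons c p) [:(1 - \<delta>) * \<beta>, \<delta>:] * g =
        smult c g + smult \<delta> (?p * (X * g)) + smult ((1 - \<delta>) * \<beta>) (?p * g)"
      by (rule poly_ext) (simp add: pcompose_pCons X_def algebra_simps)
    then show "poly ?f \<beta> = L (pcompose (pCons c p) [:(1 - \<delta>) * \<beta>, \<delta>:] * g)"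
      by (simp only: L_add L_smult) (simp add: f1 f2 X_def)
  qed
qed

lemma convolution_moments:
  assumes d: "0 \<le> \<delta>" "\<delta> < 1" and \<sigma>: "\<sigma> \<in> prob_measures" and \<eta>: "\<eta> \<in> prob_measures"
  shows "ifs_convolution \<delta> \<sigma> \<eta> \<in> prob_measures"
    and "\<exists>inner_moment. convolution (moment \<sigma>) (moment \<eta>) (moment (ifs_convolution \<delta> \<sigma> \<eta>)) \<delta> inner_moment"
proof -
  let ?\<nu> = "ifs_convolution \<delta> \<sigma> \<eta>"
  show \<nu>: "?\<nu> \<in> prob_measures"
    using ifs_convolution_distr(1)[OF assms] ifs_convolution_eq_distr[OF assms] by simp
  interpret E: moment_functional "moment \<eta>" by (rule moment_functional_moment) fact
  interpret S: moment_functional "moment \<sigma>" by (rule moment_functional_moment) fact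
  interpret B: moment_functional "moment ?\<nu>" by (rule moment_functional_moment) fact
  have "\<forall>g p. \<exists>f. degree f \<le> degree p \<and>
      (\<forall>\<beta>. poly f \<beta> = moment \<eta> (pcompose p [:(1 - \<delta>) * \<beta>, \<delta>:] * g))"
    using inner_moment_exists[OF E.moment_functional_axioms] by blast
  then obtain inner_moment where inner_moment: "\<And>g p. degree (inner_moment g p) \<le> degree p"
    "\<And>g p \<beta>. poly (inner_moment g p) \<beta> = moment \<eta> (pcompose p [:(1 - \<delta>) * \<beta>, \<delta>:] * g)"
    by metis
  have "moment ?\<nu> p = moment \<sigma> (inner_moment 1 p)" for p
  proof -
    have "moment ?\<nu> p = (\<integral>\<beta>. (\<integral>s. poly p (ifs_map \<delta> \<beta> s) \<partial>\<eta>) \<partial>\<sigma>)"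
      unfolding moment_def ifs_convolution_eq_distr[OF assms]
      by (rule ifs_convolution_distr(2)[OF assms]) (intro continuous_intros)
    also have "\<dots> = moment \<sigma> (inner_moment 1 p)"
      by (simp add: moment_def inner_moment poly_pcompose ifs_map_def algebra_simps)
    finally show ?thesis .
  qed
  then have "convolution (moment \<sigma>) (moment \<eta>) (moment ?\<nu>) \<delta> inner_moment"
    by unfold_locales (use inner_moment in auto)
  then show "\<exists>inner_moment. convolution (moment \<sigma>) (moment \<eta>) (moment ?\<nu>) \<delta> inner_moment" by blast
qed

section \<open>Correctness rules for loops\<close>

text \<open>The specification of a command that emits nothing. Loop number \<open>r\<close> counts in register \<open>r\<close> and must
preserve the registers below \<open>r\<close>, which hold the round number and the counters of the enclosing
loops; the other registers are left unspecified.\<close>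

definition runs :: "input \<Rightarrow> nat \<Rightarrow> com \<Rightarrow> state \<Rightarrow> (nat list \<Rightarrow> real) \<Rightarrow> bool" where
  "runs inp r c st m \<longleftrightarrow>
     (\<exists>rg. exec inp c st = Some (State rg m (emitted st)) \<and> (\<forall>i<r. rg i = regs st i))"

lemma runs_Store:
  "rval inp st e = Some x \<Longrightarrow> m = (mem st)(map (ival (regs st)) es := x) \<Longrightarrow> runs inp r (Store es e) st m"
  by (simp add: runs_def)

lemma runs_Seq:
  assumes "runs inp r c st m"
    and "\<And>rg. (\<forall>i<r. rg i = regs st i) \<Longrightarrow> runs inp r d (State rg m (emitted st)) m'"
  shows "runs inp r (Seq c d) st m'"
  using assms unfolding runs_def by fastforce

lemma runs_For:
  assumes n: "ival (regs st) e = n" and 0: "mem st = M 0"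
    and step: "\<And>k rg. k < n \<Longrightarrow> \<forall>i<r. rg i = regs st i \<Longrightarrow> rg r = k \<Longrightarrow>
      runs inp (Suc r) c (State rg (M k) (emitted st)) (M (Suc k))"
  shows "runs inp r (For r e c) st (M n)"
proof -
  let ?f = "\<lambda>k so. Option.bind so (\<lambda>s. exec inp c (State ((regs s)(r := k)) (mem s) (emitted s)))"
  have "\<exists>rg. fold ?f [0..<k] (Some st) = Some (State rg (M k) (emitted st)) \<and> (\<forall>i<r. rg i = regs st i)"
    if "k \<le> n" for k
    using that
  proof (induction k)
    case 0
    then show ?case using \<open>mem st = M 0\<close> by (intro exI[of _ "regs st"]) (cases st, simp)
  next
    case (Suc k)
    then obtain rg where rg: "fold ?f [0..<k] (Some st) = Some (State rg (M k) (emitted st))"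
      "\<forall>i<r. rg i = regs st i" using Suc_leD by blast
    obtain rg' where *: "exec inp c (State (rg(r := k)) (M k) (emitted st)) = Some (State rg' (M (Suc k)) (emitted st))"
      "\<forall>i<Suc r. rg' i = (rg(r := k)) i"
    proof -
      have "runs inp (Suc r) c (State (rg(r := k)) (M k) (emitted st)) (M (Suc k))"
        using Suc.prems rg(2) by (intro step) auto
      then show ?thesis using that by (auto simp: runs_def simp del: fun_upd_apply)
    qed
    then have "\<forall>i<r. rg' i = regs st i" using rg(2) by simp
    with * rg(1) show ?case by (intro exI[of _ rg']) (simp del: fun_upd_apply)
  qed
  from this[of n] show ?thesis using n by (simp add: runs_def)
qed

text \<open>The start value \<open>y\<close> of the accumulator is arbitrary so that the rule can be nested for multiple
sums.\<close>

lemma runs_For_sum: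
  assumes "ival (regs st) e = n" and "mem st = m(cell := y)"
    and step: "\<And>k rg z. k < n \<Longrightarrow> \<forall>i<r. rg i = regs st i \<Longrightarrow> rg r = k \<Longrightarrow>
      runs inp (Suc r) c (State rg (m(cell := z)) (emitted st)) (m(cell := z + g k))"
  shows "runs inp r (For r e c) st (m(cell := y + (\<Sum>k<n. g k)))"
  by (rule runs_For[where M = "\<lambda>k. m(cell := y + (\<Sum>k<k. g k))"])
    (use assms in \<open>auto simp flip: add.assoc\<close>)

text \<open>The memory \<open>m\<close> with the array number \<open>N\<close> overwritten on the positions in \<open>D\<close>; growing \<open>D\<close> describes
the progress of a double loop that fills the array.\<close>

definition grid :: "(nat list \<Rightarrow> real) \<Rightarrow> nat \<Rightarrow> (nat \<Rightarrow> nat \<Rightarrow> real) \<Rightarrow> (nat \<times> nat) set \<Rightarrow> nat list \<Rightarrow> real" where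
  "grid m N f D xs = (case xs of [k, i, j] \<Rightarrow> if k = N \<and> (i, j) \<in> D then f i j else m xs | _ \<Rightarrow> m xs)"

lemma grid_3 [simp]: "grid m N f D [k, i, j] = (if k = N \<and> (i, j) \<in> D then f i j else m [k, i, j])"
  and grid_2 [simp]: "grid m N f D [k, i] = m [k, i]"
  by (simp_all add: grid_def)

lemma grid_insert: "(grid m N f D)([N, i, j] := f i j) = grid m N f (insert (i, j) D)"
  by (rule ext) (auto simp: grid_def split: list.split)

lemma grid_empty: "grid m N f {} = m"
  by (rule ext) (auto simp: grid_def split: list.split)

text \<open>The body may read the old content of the position that it overwrites, as \<open>(i, j) \<notin> D\<close>.\<close>

lemma runs_For_grid:
  assumes e: "\<And>rg. rg 0 = N \<Longrightarrow> ival rg e = n" and N: "regs st 0 = N"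
    and step: "\<And>rg D i j. i < n \<Longrightarrow> j < n \<Longrightarrow> (i, j) \<notin> D \<Longrightarrow> rg 0 = N \<Longrightarrow> rg (Suc 0) = i \<Longrightarrow> rg 2 = j \<Longrightarrow>
      runs inp 3 c (State rg (grid (mem st) N f D) (emitted st)) ((grid (mem st) N f D)([N, i, j] := f i j))"
  shows "runs inp (Suc 0) (For (Suc 0) e (For 2 e c)) st (grid (mem st) N f ({..<n} \<times> {..<n}))"
proof (rule runs_For[where M = "\<lambda>i. grid (mem st) N f ({..<i} \<times> {..<n})"])
  fix i rg assume i: "i < n" "\<forall>k<Suc 0. rg k = regs st k" "rg (Suc 0) = i"
  have "runs inp 2 (For 2 e c) (State rg (grid (mem st) N f ({..<i} \<times> {..<n})) (emitted st))
      (grid (mem st) N f ({..<i} \<times> {..<n} \<union> {i} \<times> {..<n}))"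
  proof (rule runs_For[where M = "\<lambda>j. grid (mem st) N f ({..<i} \<times> {..<n} \<union> {i} \<times> {..<j})"])
    fix j rg' assume j: "j < n" "\<forall>k<2. rg' k = regs (State rg (grid (mem st) N f ({..<i} \<times> {..<n})) (emitted st)) k"
      "rg' 2 = j"
    have "runs inp 3 c (State rg' (grid (mem st) N f ({..<i} \<times> {..<n} \<union> {i} \<times> {..<j})) (emitted st))
      ((grid (mem st) N f ({..<i} \<times> {..<n} \<union> {i} \<times> {..<j}))([N, i, j] := f i j))"
      using i j N by (intro step) auto
    then show "runs inp (Suc 2) c (State rg' (grid (mem st) N f ({..<i} \<times> {..<n} \<union> {i} \<times> {..<j}))
        (emitted (State rg (grid (mem st) N f ({..<i} \<times> {..<n})) (emitted st))))
      (grid (mem st) N f ({..<i} \<times> {..<n} \<union> {i} \<times> {..<Suc j}))"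
      by (simp add: grid_insert lessThan_Suc numeral_3_eq_3 numeral_2_eq_2)
  qed (use i N e in auto)
  moreover have "{..<i} \<times> {..<n} \<union> {i} \<times> {..<n} = {..<Suc i} \<times> {..<n}" by auto
  ultimately show "runs inp (Suc (Suc 0)) (For 2 e c) (State rg (grid (mem st) N f ({..<i} \<times> {..<n})) (emitted st))
      (grid (mem st) N f ({..<Suc i} \<times> {..<n}))" by (simp add: numeral_2_eq_2)
qed (use N e in \<open>auto simp: grid_empty\<close>)

section \<open>The Lanczos program\<close>

abbreviation "row_i \<equiv> Reg (Suc 0)"
abbreviation "col_j \<equiv> Reg 2"
abbreviation "idx_l \<equiv> Reg 3"
abbreviation "now \<equiv> Reg 0"
abbreviation "width \<equiv> Plus now (Num 1)"
abbreviation "prev1 \<equiv> Minus now (Num 1)"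
abbreviation "prev2 \<equiv> Minus now (Num 2)"

text \<open>One summand of the matrix-vector product of $\bar\delta\,J_\sigma\otimes 1 + \delta\,1\otimes J_\eta$
with the array number \<open>k\<close>, at the position given by \<open>row_i\<close> and \<open>col_j\<close>.\<close>

definition product_term :: "idx \<Rightarrow> rexp" where
  "product_term k = Add
     (Mul (Mul (Sub One Delta) (Sigma_entry row_i idx_l)) (Mem [k, idx_l, col_j]))
     (Mul (Mul Delta (Eta_entry col_j idx_l)) (Mem [k, row_i, idx_l]))"

definition residual_com :: com where
  "residual_com = For (Suc 0) width (For 2 width (Seq
     (Store [now, row_i, col_j] (Sub
        (Sub Zero (Mul (Mem [Num 0, prev1]) (Mem [prev1, row_i, col_j])))
        (Mul (Mem [Num 1, prev1]) (Mem [prev2, row_i, col_j]))))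
     (For 3 width (Store [now, row_i, col_j]
        (Add (Mem [now, row_i, col_j]) (product_term prev1))))))"

definition norm_com :: com where
  "norm_com = Seq
     (For (Suc 0) width (For 2 width (Store [Num 2, now]
        (Add (Mem [Num 2, now]) (Mul (Mem [now, row_i, col_j]) (Mem [now, row_i, col_j]))))))
     (Store [Num 1, now] (Sqrt (Mem [Num 2, now])))"

definition normalize_com :: com where
  "normalize_com = For (Suc 0) width (For 2 width
     (Store [now, row_i, col_j] (Div (Mem [now, row_i, col_j]) (Mem [Num 1, now]))))"

definition diagonal_com :: com where
  "diagonal_com = For (Suc 0) width (For 2 width (For 3 width (Store [Num 0, now]
     (Add (Mem [Num 0, now]) (Mul (Mem [now, row_i, col_j]) (product_term now))))))"

definition finish_com :: com where
  "finish_com = Seq diagonal_com (Emit (Mem [Num 0, now]))"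

text \<open>Register 0 holds the number $N$ of the round. Cells \<open>[k, i, j]\<close> contain the coefficient array of
$p_k$, cells \<open>[0, k]\<close>, \<open>[1, k]\<close>, \<open>[2, k]\<close> the numbers $a_k$, $b_k$, $b_k^2$. If $b_N = 0$, the array
of the residual, which is then zero, stays in place as that of $p_N$, and the next rounds find
$b = 0$ again.\<close>

definition lanczos_com :: com where
  "lanczos_com = Seq
     (If_Eq now (Num 0)
        (Seq (Store [now, Num 0, Num 0] One) finish_com)
        (Seq residual_com (Seq norm_com
           (If_Zero (Mem [Num 1, now]) Skip
              (Seq normalize_com (Seq (Emit (Mem [Num 1, now])) finish_com))))))
     (Set_Reg 0 width)"

text \<open>The value of \<open>product_term\<close> for the array \<open>u\<close>.\<close>

definition kron_term :: "input \<Rightarrow> (nat \<Rightarrow> nat \<Rightarrow> real) \<Rightarrow> nat \<Rightarrow> nat \<Rightarrow> nat \<Rightarrow> real" where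
  "kron_term inp u i j l = (1 - in_delta inp) * entry (in_sigma inp) i l * u l j
     + in_delta inp * entry (in_eta inp) j l * u i l"

text \<open>The mathematical content of the Lanczos algorithm, as equations between coefficient arrays \<open>v k\<close>,
residual arrays \<open>w k\<close> and numbers \<open>a k\<close>, \<open>b k\<close>. The input enters only in the last two assumptions,
which are restricted to indices below \<open>n\<close>: they hold for any input that agrees with the Jacobi
matrices up to that size.\<close>

locale lanczos_table =
  fixes inp :: input and v w :: "nat \<Rightarrow> nat \<Rightarrow> nat \<Rightarrow> real" and a b :: "nat \<Rightarrow> real" and n :: nat
  assumes v_0: "v 0 i j = (if i = 0 \<and> j = 0 then 1 else 0)"
    and v_outside: "k < i \<or> k < j \<Longrightarrow> v k i j = 0"
    and v_Suc: "v (Suc k) i j = w k i j / b (Suc k)"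
    and b_0: "b 0 = 0"
    and b_Suc: "b (Suc k) = sqrt (\<Sum>i\<le>Suc k. \<Sum>j\<le>Suc k. w k i j * w k i j)"
    and w_eq: "Suc k < n \<Longrightarrow> i \<le> Suc k \<Longrightarrow> j \<le> Suc k \<Longrightarrow>
      w k i j = (\<Sum>l\<le>Suc k. kron_term inp (v k) i j l) - a k * v k i j - b k * v (k - 1) i j"
    and a_eq: "k < n \<Longrightarrow> a k = (\<Sum>i\<le>k. \<Sum>j\<le>k. \<Sum>l\<le>k. v k i j * kron_term inp (v k) i j l)"
begin

text \<open>The memory before round \<open>N\<close>, described exactly: the cells for round \<open>N\<close> are still zero, and the
accumulating loops rely on that. The arrays are given on all indices because the sums reach one
index beyond the part of the previous array that was stored.\<close>

definition memory :: "nat \<Rightarrow> nat list \<Rightarrow> real" where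
  "memory N xs = (case xs of
      [c, k] \<Rightarrow> if k < N then (if c = 0 then a k else if c = 1 then b k else if c = 2 then b k * b k else 0) else 0
    | [k, i, j] \<Rightarrow> if k < N then v k i j else 0
    | _ \<Rightarrow> 0)"

lemma memory_3 [simp]: "memory N [k, i, j] = (if k < N then v k i j else 0)"
  and memory_2 [simp]: "memory N [c, k] =
    (if k < N then (if c = 0 then a k else if c = 1 then b k else if c = 2 then b k * b k else 0) else 0)"
  by (simp_all add: memory_def)

lemma w_eq_0:
  assumes "b (Suc k) = 0" "i \<le> Suc k" "j \<le> Suc k"
  shows "w k i j = 0"
proof -
  have "(\<Sum>i\<le>Suc k. \<Sum>j\<le>Suc k. w k i j * w k i j) = 0"
    using assms(1) by (simp add: b_Suc)
  then have "(\<Sum>j\<le>Suc k. w k i j * w k i j) = 0"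
    using assms(2) by (subst (asm) sum_nonneg_eq_0_iff) (auto intro!: sum_nonneg simp del: sum.atMost_Suc)
  then show ?thesis
    using assms(3) by (subst (asm) sum_nonneg_eq_0_iff) (auto simp del: sum.atMost_Suc)
qed

lemma rval_product_term:
  assumes "\<And>i j. mem st [ival (regs st) e, i, j] = v k i j"
    and "regs st (Suc 0) = i" "regs st 2 = j" "regs st 3 = l"
  shows "rval inp st (product_term e) = Some (kron_term inp (v k) i j l)"
  using assms by (simp add: product_term_def kron_term_def)

lemma runs_residual:
  assumes N: "regs st 0 = Suc k" and k: "Suc k < n" and mem: "mem st = memory (Suc k)"
  shows "runs inp (Suc 0) residual_com st
    (grid (memory (Suc k)) (Suc k) (w k) ({..<Suc (Suc k)} \<times> {..<Suc (Suc k)}))"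
  unfolding residual_com_def mem[symmetric]
proof (rule runs_For_grid)
  fix rg :: "nat \<Rightarrow> nat" and D i j
  assume ij: "i < Suc (Suc k)" "j < Suc (Suc k)" "(i, j) \<notin> D"
    and rg: "rg 0 = Suc k" "rg (Suc 0) = i" "rg 2 = j"
  let ?m = "grid (mem st) (Suc k) (w k) D"
  \<comment> \<open>For \<open>k = 0\<close> the truncated \<open>k - 1\<close> is harmless because of \<open>b 0 = 0\<close>.\<close>
  let ?y = "- a k * v k i j - b k * v (k - 1) i j"
  show "runs inp 3 (Seq (Store [now, row_i, col_j] (Sub
        (Sub Zero (Mul (Mem [Num 0, prev1]) (Mem [prev1, row_i, col_j])))
        (Mul (Mem [Num 1, prev1]) (Mem [prev2, row_i, col_j]))))
     (For 3 width (Store [now, row_i, col_j]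
        (Add (Mem [now, row_i, col_j]) (product_term prev1)))))
     (State rg ?m (emitted st)) (?m([Suc k, i, j] := w k i j))"
  proof (rule runs_Seq)
    show "runs inp 3 (Store [now, row_i, col_j] (Sub
        (Sub Zero (Mul (Mem [Num 0, prev1]) (Mem [prev1, row_i, col_j])))
        (Mul (Mem [Num 1, prev1]) (Mem [prev2, row_i, col_j])))) (State rg ?m (emitted st))
        (?m([Suc k, i, j] := ?y))"
      using rg mem by (intro runs_Store) auto
  next
    fix rg' assume rg': "\<forall>i<3. rg' i = regs (State rg ?m (emitted st)) i"
    have "runs inp 3 (For 3 width (Store [now, row_i, col_j]
        (Add (Mem [now, row_i, col_j]) (product_term prev1))))
      (State rg' (?m([Suc k, i, j] := ?y)) (emitted st))
      (?m([Suc k, i, j] := ?y + (\<Sum>l<Suc (Suc k). kron_term inp (v k) i j l)))"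
    proof (rule runs_For_sum)
      fix l rg'' z
      assume rg'': "\<forall>x<3. rg'' x = regs (State rg' (?m([Suc k, i, j] := ?y)) (emitted st)) x" "rg'' 3 = l"
      let ?st = "State rg'' (?m([Suc k, i, j] := z)) (emitted (State rg' (?m([Suc k, i, j] := ?y)) (emitted st)))"
      have r: "rg'' 0 = Suc k" "rg'' (Suc 0) = i" "rg'' 2 = j" "rg'' 3 = l"
        using rg rg' rg'' by auto
      have "rval inp ?st (product_term prev1) = Some (kron_term inp (v k) i j l)"
        using r mem by (intro rval_product_term) auto
      then show "runs inp (Suc 3) (Store [now, row_i, col_j]
        (Add (Mem [now, row_i, col_j]) (product_term prev1))) ?st (?m([Suc k, i, j] := z + kron_term inp (v k) i j l))"
        using r by (intro runs_Store) auto
    qed (use rg rg' in auto)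
    moreover have "w k i j = ?y + (\<Sum>l<Suc (Suc k). kron_term inp (v k) i j l)"
      using w_eq[OF k, of i j] ij by (simp add: lessThan_Suc_atMost del: sum.lessThan_Suc sum.atMost_Suc)
    ultimately show "runs inp 3 (For 3 width (Store [now, row_i, col_j]
        (Add (Mem [now, row_i, col_j]) (product_term prev1))))
      (State rg' (?m([Suc k, i, j] := ?y)) (emitted (State rg ?m (emitted st))))
      (?m([Suc k, i, j] := w k i j))" by simp
  qed
qed (use N in auto)

lemma runs_norm:
  assumes N: "regs st 0 = Suc k"
    and m: "\<And>i j. i \<le> Suc k \<Longrightarrow> j \<le> Suc k \<Longrightarrow> mem st [Suc k, i, j] = w k i j"
    and m0: "mem st [2, Suc k] = 0"
  shows "runs inp (Suc 0) norm_com st ((mem st)([2, Suc k] := b (Suc k) * b (Suc k), [1, Suc k] := b (Suc k)))"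
proof -
  define y where "y = (\<Sum>i<Suc (Suc k). \<Sum>j<Suc (Suc k). w k i j * w k i j)"
  have y0: "y \<ge> 0" unfolding y_def by (intro sum_nonneg) simp
  have bs: "b (Suc k) = sqrt y" unfolding y_def b_Suc lessThan_Suc_atMost ..
  have sq: "y = b (Suc k) * b (Suc k)" using y0 by (simp add: bs)
  have "runs inp (Suc 0) (For (Suc 0) width (For 2 width (Store [Num 2, now]
        (Add (Mem [Num 2, now]) (Mul (Mem [now, row_i, col_j]) (Mem [now, row_i, col_j]))))))
      st ((mem st)([2, Suc k] := 0 + y))"
    unfolding y_def
  proof (rule runs_For_sum)
    show "mem st = (mem st)([2, Suc k] := 0)" using m0 by auto
    fix i rg z assume i: "i < Suc (Suc k)" "\<forall>i<Suc 0. rg i = regs st i" "rg (Suc 0) = i"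
    show "runs inp (Suc (Suc 0)) (For 2 width (Store [Num 2, now]
        (Add (Mem [Num 2, now]) (Mul (Mem [now, row_i, col_j]) (Mem [now, row_i, col_j])))))
        (State rg ((mem st)([2, Suc k] := z)) (emitted st))
        ((mem st)([2, Suc k] := z + (\<Sum>j<Suc (Suc k). w k i j * w k i j)))"
      unfolding numeral_2_eq_2[symmetric]
    proof (rule runs_For_sum)
      fix j rg' z' assume j: "j < Suc (Suc k)" "\<forall>i<2. rg' i = regs (State rg ((mem st)([2, Suc k] := z)) (emitted st)) i"
        "rg' 2 = j"
      show "runs inp (Suc 2) (Store [Num 2, now]
        (Add (Mem [Num 2, now]) (Mul (Mem [now, row_i, col_j]) (Mem [now, row_i, col_j]))))
        (State rg' ((mem st)([2, Suc k] := z')) (emitted (State rg ((mem st)([2, Suc k] := z)) (emitted st))))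
        ((mem st)([2, Suc k] := z' + w k i j * w k i j))"
        using i j m N by (intro runs_Store) auto
    qed (use i N in auto)
  qed (use N in auto)
  then show ?thesis
    unfolding norm_com_def
  proof (rule runs_Seq)
    fix rg assume "\<forall>i<Suc 0. rg i = regs st i"
    then show "runs inp (Suc 0) (Store [Num 1, now] (Sqrt (Mem [Num 2, now])))
        (State rg ((mem st)([2, Suc k] := 0 + y)) (emitted st))
        ((mem st)([2, Suc k] := b (Suc k) * b (Suc k), [1, Suc k] := b (Suc k)))"
      using N y0 by (intro runs_Store) (auto simp: bs[symmetric] sq[symmetric])
  qed
qed

lemma runs_normalize:
  assumes N: "regs st 0 = Suc k"
    and m: "\<And>i j. i \<le> Suc k \<Longrightarrow> j \<le> Suc k \<Longrightarrow> mem st [Suc k, i, j] = w k i j"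
    and b: "mem st [1, Suc k] = b (Suc k)" "b (Suc k) \<noteq> 0"
  shows "runs inp (Suc 0) normalize_com st
    (grid (mem st) (Suc k) (v (Suc k)) ({..<Suc (Suc k)} \<times> {..<Suc (Suc k)}))"
  unfolding normalize_com_def
  by (rule runs_For_grid, goal_cases) (use N m b in \<open>auto intro!: runs_Store simp: v_Suc\<close>)

lemma runs_diagonal:
  assumes N: "regs st 0 = k" and k: "k < n"
    and m: "\<And>i j. mem st [k, i, j] = v k i j" and m0: "mem st [0, k] = 0"
  shows "runs inp (Suc 0) diagonal_com st ((mem st)([0, k] := a k))"
proof -
  let ?g = "\<lambda>i j l. v k i j * kron_term inp (v k) i j l"
  let ?store = "Store [Num 0, now] (Add (Mem [Num 0, now]) (Mul (Mem [now, row_i, col_j]) (product_term now)))"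
  have "runs inp (Suc 0) diagonal_com st
      ((mem st)([0, k] := 0 + (\<Sum>i<Suc k. \<Sum>j<Suc k. \<Sum>l<Suc k. ?g i j l)))"
    unfolding diagonal_com_def
  proof (rule runs_For_sum)
    show "mem st = (mem st)([0, k] := 0)" using m0 by auto
    fix i rg z assume i: "\<forall>i<Suc 0. rg i = regs st i" "rg (Suc 0) = i"
    show "runs inp (Suc (Suc 0)) (For 2 width (For 3 width ?store))
        (State rg ((mem st)([0, k] := z)) (emitted st))
        ((mem st)([0, k] := z + (\<Sum>j<Suc k. \<Sum>l<Suc k. ?g i j l)))"
      unfolding numeral_2_eq_2[symmetric]
    proof (rule runs_For_sum)
      fix j rg' z' assume j: "\<forall>i<2. rg' i = regs (State rg ((mem st)([0, k] := z)) (emitted st)) i" "rg' 2 = j"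
      have 3: "Suc 2 = 3" by simp
      show "runs inp (Suc 2) (For 3 width ?store)
        (State rg' ((mem st)([0, k] := z')) (emitted (State rg ((mem st)([0, k] := z)) (emitted st))))
        ((mem st)([0, k] := z' + (\<Sum>l<Suc k. ?g i j l)))"
        unfolding 3
      proof (rule runs_For_sum)
        fix l rg'' y
        assume l: "\<forall>i<3. rg'' i = regs (State rg' ((mem st)([0, k] := z'))
            (emitted (State rg ((mem st)([0, k] := z)) (emitted st)))) i" "rg'' 3 = l"
        let ?st = "State rg'' ((mem st)([0, k] := y)) (emitted (State rg' ((mem st)([0, k] := z'))
            (emitted (State rg ((mem st)([0, k] := z)) (emitted st)))))"
        have r: "rg'' 0 = k" "rg'' (Suc 0) = i" "rg'' 2 = j" "rg'' 3 = l"
          using N i j l by auto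
        have "rval inp ?st (product_term now) = Some (kron_term inp (v k) i j l)"
          using r m by (intro rval_product_term) auto
        then show "runs inp (Suc 3) ?store ?st ((mem st)([0, k] := y + ?g i j l))"
          using r m by (intro runs_Store) auto
      qed (use N i j in auto)
    qed (use i N in auto)
  qed (use N in auto)
  then show ?thesis
    using a_eq[OF k] by (simp add: lessThan_Suc_atMost del: sum.lessThan_Suc sum.atMost_Suc)
qed

lemma exec_finish:
  assumes "regs st 0 = k" "k < n" "\<And>i j. mem st [k, i, j] = v k i j" "mem st [0, k] = 0"
  shows "\<exists>rg. rg 0 = k \<and> exec inp finish_com st =
    Some (State rg ((mem st)([0, k] := a k)) (emitted st @ [a k]))"
  using runs_diagonal[OF assms] assms(1) by (auto simp: finish_com_def runs_def)

lemma memory_Suc: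
  assumes "\<And>i j. m [k, i, j] = v k i j"
    and "m [0, k] = a k" "m [1, k] = b k" "m [2, k] = b k * b k"
    and "\<And>xs. \<nexists>i j. xs = [k, i, j] \<Longrightarrow> xs \<noteq> [0, k] \<Longrightarrow> xs \<noteq> [1, k] \<Longrightarrow> xs \<noteq> [2, k] \<Longrightarrow> m xs = memory k xs"
  shows "m = memory (Suc k)"
proof
  fix xs
  show "m xs = memory (Suc k) xs"
  proof (cases "\<exists>i j. xs = [k, i, j]")
    case False
    show ?thesis
    proof (cases "xs = [0, k] \<or> xs = [1, k] \<or> xs = [2, k]")
      case True
      then show ?thesis using assms by auto
    next
      case False
      then have "m xs = memory k xs" using assms(5) \<open>\<not> (\<exists>i j. xs = [k, i, j])\<close> by blast
      also have "\<dots> = memory (Suc k) xs"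
        using False \<open>\<not> (\<exists>i j. xs = [k, i, j])\<close>
        by (auto simp: memory_def less_Suc_eq split: list.split)
      finally show ?thesis .
    qed
  qed (use assms in auto)
qed

lemma exec_lanczos_com:
  assumes N: "rg 0 = N" "N < n"
  shows "\<exists>rg'. rg' 0 = Suc N \<and> exec inp lanczos_com (State rg (memory N) out) =
    Some (State rg' (memory (Suc N)) (out @ jacobi_row a b N))"
proof (cases N)
  case 0
  \<comment> \<open>The constant polynomial 1 has the single coefficient 1 at position (0, 0).\<close>
  let ?m = "(memory 0)([0, 0, 0] := 1)"
  have "?m [0, i, j] = v 0 i j" for i j by (simp add: v_0)
  then obtain rg' where rg': "rg' 0 = 0" "exec inp finish_com (State rg ?m out) =
      Some (State rg' (?m([0, 0] := a 0)) (out @ [a 0]))"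
    using exec_finish[of "State rg ?m out" 0] N 0 by auto
  have "?m([0, 0] := a 0) = memory (Suc 0)"
    by (rule memory_Suc) (auto simp: v_0 b_0)
  then show ?thesis using rg' N 0
    by (simp add: lanczos_com_def jacobi_row_def)
next
  case (Suc k)
  let ?box = "{..<Suc (Suc k)} \<times> {..<Suc (Suc k)}"
  let ?m1 = "grid (memory (Suc k)) (Suc k) (w k) ?box"
  let ?m2 = "?m1([2, Suc k] := b (Suc k) * b (Suc k), [1, Suc k] := b (Suc k))"
  obtain rg1 where 1: "rg1 0 = Suc k" "exec inp residual_com (State rg (memory N) out) = Some (State rg1 ?m1 out)"
    using runs_residual[of "State rg (memory N) out" k] N Suc by (auto simp: runs_def)
  obtain rg2 where 2: "rg2 0 = Suc k" "exec inp norm_com (State rg1 ?m1 out) = Some (State rg2 ?m2 out)"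
    using runs_norm[of "State rg1 ?m1 out" k] 1 by (auto simp: runs_def)
  show ?thesis
  proof (cases "b (Suc k) = 0")
    case True
    have v: "v (Suc k) i j = 0" for i j by (simp add: v_Suc True)
    have a: "a (Suc k) = 0" using a_eq[of "Suc k"] N Suc by (simp add: v)
    have "?m2 = memory (Suc N)"
      unfolding Suc
      by (rule memory_Suc) (use True in \<open>auto simp: v a w_eq_0 grid_def split: list.split\<close>)
    then show ?thesis using 1 2 N Suc True by (simp add: lanczos_com_def jacobi_row_def)
  next
    case False
    let ?m3 = "grid ?m2 (Suc k) (v (Suc k)) ?box"
    obtain rg3 where 3: "rg3 0 = Suc k" "exec inp normalize_com (State rg2 ?m2 out) = Some (State rg3 ?m3 out)"
      using runs_normalize[of "State rg2 ?m2 out" k] 2 False by (auto simp: runs_def)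
    obtain rg4 where 4: "rg4 0 = Suc k" "exec inp finish_com (State rg3 ?m3 (out @ [b (Suc k)])) =
        Some (State rg4 (?m3([0, Suc k] := a (Suc k))) (out @ [b (Suc k), a (Suc k)]))"
    proof -
      let ?st = "State rg3 ?m3 (out @ [b (Suc k)])"
      have "\<exists>rg. rg 0 = Suc k \<and> exec inp finish_com ?st =
          Some (State rg ((mem ?st)([0, Suc k] := a (Suc k))) (emitted ?st @ [a (Suc k)]))"
        by (rule exec_finish) (use N Suc 3 in \<open>auto simp: v_outside\<close>)
      then show ?thesis using that by auto
    qed
    have "?m3([0, Suc k] := a (Suc k)) = memory (Suc N)"
      unfolding Suc
      by (rule memory_Suc) (auto simp: v_outside grid_def split: list.split)
    then show ?thesis using 1 2 3 4 N Suc False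
      by (simp add: lanczos_com_def jacobi_row_def)
  qed
qed

theorem output_after_lanczos_com:
  "output_after lanczos_com inp n = Some (concat (map (jacobi_row a b) [0..<n]))"
proof -
  let ?f = "\<lambda>so. Option.bind so (exec inp lanczos_com)"
  have 0: "memory 0 = (\<lambda>_. 0)"
    by (rule ext) (auto simp: memory_def split: list.split)
  have "\<exists>rg. rg 0 = k \<and> (?f ^^ k) (Some (State (\<lambda>_. 0) (\<lambda>_. 0) [])) =
      Some (State rg (memory k) (concat (map (jacobi_row a b) [0..<k])))" if "k \<le> n" for k
    using that
  proof (induction k)
    case (Suc k)
    then obtain rg where "rg 0 = k" "(?f ^^ k) (Some (State (\<lambda>_. 0) (\<lambda>_. 0) [])) =
      Some (State rg (memory k) (concat (map (jacobi_row a b) [0..<k])))" by auto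
    then show ?case using exec_lanczos_com[of rg k "concat (map (jacobi_row a b) [0..<k])"] Suc.prems by auto
  qed (simp add: 0)
  from this[of n] show ?thesis by (auto simp: output_after_def)
qed

end

section \<open>Recursive computability of the Jacobi matrix\<close>

text \<open>Complete and truncated matrices are treated at once, as only the entries with indices below \<open>n\<close>
are prescribed.\<close>

lemma output_after_lanczos:
  assumes d: "0 \<le> \<delta>" "\<delta> < 1" and \<sigma>: "\<sigma> \<in> prob_measures" and \<eta>: "\<eta> \<in> prob_measures"
    and inp: "in_delta inp = \<delta>"
      "\<And>i j. i < n \<Longrightarrow> j < n \<Longrightarrow> entry (in_sigma inp) i j = entry (jacobi \<sigma>) i j"
      "\<And>i j. i < n \<Longrightarrow> j < n \<Longrightarrow> entry (in_eta inp) i j = entry (jacobi \<eta>) i j"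
  shows "output_after lanczos_com inp n = Some (entry_list (truncation n (jacobi (ifs_convolution \<delta> \<sigma> \<eta>))))"
proof -
  let ?\<nu> = "ifs_convolution \<delta> \<sigma> \<eta>"
  have \<nu>: "?\<nu> \<in> prob_measures" by (rule convolution_moments(1)) fact+
  obtain inner_moment where "convolution (moment \<sigma>) (moment \<eta>) (moment ?\<nu>) \<delta> inner_moment"
    using convolution_moments(2)[OF d \<sigma> \<eta>] by blast
  then interpret convolution "moment \<sigma>" "moment \<eta>" "moment ?\<nu>" \<delta> inner_moment .
  let ?L = "moment ?\<nu>"
  let ?v = "\<lambda>k. coef (opoly ?L k)"
  have kron: "kron_term inp u i j l = (1 - \<delta>) * moment \<sigma> (X * opoly (moment \<sigma>) i * opoly (moment \<sigma>) l) * u l j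
      + \<delta> * moment \<eta> (X * opoly (moment \<eta>) j * opoly (moment \<eta>) l) * u i l"
    if "i < n" "j < n" "l < n" for u i j l
    using that inp by (simp add: kron_term_def entry_jacobi \<sigma> \<eta>)
  interpret lanczos_table inp ?v "\<lambda>k. coef (residual ?L k)" "jac_a ?L" "jac_b ?L" n
  proof
    fix k i j
    show "?v 0 i j = (if i = 0 \<and> j = 0 then 1 else 0)" by (simp add: coef_one)
    show "?v k i j = 0" if "k < i \<or> k < j"
      using that degree_opoly_le[of k] by (intro coef_eq_0) auto
    show "?v (Suc k) i j = coef (residual ?L k) i j / jac_b ?L (Suc k)" by (rule coef_opoly_Suc)
    show "jac_b ?L 0 = 0" by simp
    show "jac_b ?L (Suc k) = sqrt (\<Sum>i\<le>Suc k. \<Sum>j\<le>Suc k. coef (residual ?L k) i j * coef (residual ?L k) i j)"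
      by (rule jac_b_eq)
    show "coef (residual ?L k) i j = (\<Sum>l\<le>Suc k. kron_term inp (?v k) i j l)
        - jac_a ?L k * ?v k i j - jac_b ?L k * ?v (k - 1) i j"
      if "Suc k < n" "i \<le> Suc k" "j \<le> Suc k"
      unfolding coef_residual using that kron by (simp del: sum.atMost_Suc)
    show "jac_a ?L k = (\<Sum>i\<le>k. \<Sum>j\<le>k. \<Sum>l\<le>k. ?v k i j * kron_term inp (?v k) i j l)"
      if "k < n"
      unfolding jac_a_eq using that kron by simp
  qed
  show ?thesis
    using output_after_lanczos_com entry_list_truncation_jacobi[OF \<nu>] by simp
qed

theorem theorem1:
  shows "\<exists>P. \<forall>\<delta> \<sigma> \<eta>. 0 \<le> \<delta> \<and> \<delta> < 1 \<and> \<sigma> \<in> prob_measures \<and> \<eta> \<in> prob_measures \<longrightarrow>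
    generates P (Input \<delta> (jacobi \<sigma>) (jacobi \<eta>)) (jacobi (ifs_convolution \<delta> \<sigma> \<eta>)) \<and>
    (\<forall>n\<ge>1. output_after P (Input \<delta> (truncation n (jacobi \<sigma>)) (truncation n (jacobi \<eta>))) n =
            Some (entry_list (truncation n (jacobi (ifs_convolution \<delta> \<sigma> \<eta>)))))"
proof (intro exI[of _ lanczos_com] allI impI conjI)
  fix \<delta> :: real and \<sigma> \<eta>
  assume *: "0 \<le> \<delta> \<and> \<delta> < 1 \<and> \<sigma> \<in> prob_measures \<and> \<eta> \<in> prob_measures"
  show "generates lanczos_com (Input \<delta> (jacobi \<sigma>) (jacobi \<eta>)) (jacobi (ifs_convolution \<delta> \<sigma> \<eta>))"
    unfolding generates_def using * by (auto intro!: output_after_lanczos)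
  fix n :: nat
  have trunc: "entry (truncation n (jacobi \<nu>)) i j = entry (jacobi \<nu>) i j"
    if "\<nu> \<in> prob_measures" "i < n" "j < n" for \<nu> i j
    using that by (simp add: truncation_def mk_sqmat_def msize_jacobi jacobi_eq tridiagonal_def)
  show "output_after lanczos_com (Input \<delta> (truncation n (jacobi \<sigma>)) (truncation n (jacobi \<eta>))) n =
            Some (entry_list (truncation n (jacobi (ifs_convolution \<delta> \<sigma> \<eta>))))"
    using * trunc by (intro output_after_lanczos) auto
qed

end
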